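(* Fix $\lambda\in(0,1]$ and a symmetric finitely supported probability measure $\mu$ on $\mathbb R$. Let $D$ be an infinite set of positive integers $d$ such that $m=d/\lambda$ is an integer and such that there is a monic polynomial $p_d$ of degree $d$ with real nonnegative roots satisfying $\mu_{\mathbb{S}p_d}=\mu$. Then, as $d\to\infty$ along $D$, $\mathcal{R}^{d,\lambda}_{\mathbb{S}p_d}(s)\to \mathcal{R}^{\lambda}_{\mu}(s)$, both coefficientwise and pointwise for all $s$ small enough.
   Context: For $p$ monic of degree $d$ with roots $\rho_1,\dots,\rho_d\ge0$, $\mathbb{S}p(x)=p(x^2)$ and $\mu_{\mathbb{S}p}=\frac{1}{2d}\sum_{i=1}^d(\delta_{\sqrt{\rho_i}}+\delta_{-\sqrt{\rho_i}})$. Finite rectangular $R$-transform (with $m=d/\lambda$): writing $p(x)=\sum_{i=0}^d(-1)^ip_ix^{d-i}$ and $E_p(s):=\sum_{i=0}^d (-1)^i (md)^i\frac{(m-i)!(d-i)!}{m!\,d!}p_i s^i$, $\mathcal{R}^{d,\lambda}_{\mathbb{S}p}(s)$ is the unique polynomial of degree at most $d$ agreeing with $-\frac{s}{d}\frac{d}{ds}\log E_p(s)$ modulo $s^{d+1}$. Free rectangular $R$-transform (Benaych-Georges): for a compactly supported symmetric measure $\mu$, $\mathcal G_\mu(x)=\int\frac{d\mu(t)}{x-t}$; $H^\lambda_\mu(x)=\lambda\,\mathcal G_\mu(1/\sqrt x)^2+(1-\lambda)\sqrt x\,\mathcal G_\mu(1/\sqrt x)=x+O(x^2)$ is analytic near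 $0$ with compositional inverse $[H^\lambda_\mu]^{-1}$ analytic near $0$; $U^\lambda(x)=\frac{-\lambda-1+((\lambda+1)^2+4\lambda x)^{1/2}}{2\lambda}$; and $\mathcal R^\lambda_\mu(x)=U^\lambda\!\left(\frac{x}{[H^\lambda_\mu]^{-1}(x)}-1\right)$, analytic near $0$. *)

theory Defs
  imports "HOL-Probability.Probability" "HOL-Computational_Algebra.Computational_Algebra"
begin

section \<open>Empirical symmetric root measure of S p, where (S p)(x) = p(x^2)\<close>

definition sym_sqrt_roots :: "real poly \<Rightarrow> real multiset" where
  "sym_sqrt_roots p = image_mset sqrt (proots p) + image_mset (\<lambda>r. - sqrt r) (proots p)"

definition mu_S :: "real poly \<Rightarrow> real pmf" where
  "mu_S p = pmf_of_multiset (sym_sqrt_roots p)"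

text \<open>p(x) = sum_i (-1)^i p_i x^(d-i).\<close>
definition pcoef :: "nat \<Rightarrow> real poly \<Rightarrow> nat \<Rightarrow> real" where
  "pcoef d p i = (-1) ^ i * coeff p (d - i)"

definition E_fps :: "nat \<Rightarrow> nat \<Rightarrow> real poly \<Rightarrow> real fps" where
  "E_fps d m p = Abs_fps (\<lambda>i. if i \<le> d then
      (-1) ^ i * (real m * real d) ^ i * (fact (m - i) * fact (d - i) / (fact m * fact d))
        * pcoef d p i
    else 0)"

definition logderiv_fps :: "nat \<Rightarrow> nat \<Rightarrow> real poly \<Rightarrow> real fps" where
  "logderiv_fps d m p =
     fps_const (- 1 / real d) * fps_X * fps_deriv (E_fps d m p) * inverse (E_fps d m p)"

text \<open>R^{d,lambda}_{S p}: the polynomial of degree at most d agreeing with the above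
  power series modulo s^(d+1); here m = d / lambda (assumed to be an integer).\<close>
definition finite_rect_R :: "nat \<Rightarrow> real \<Rightarrow> real poly \<Rightarrow> real poly" where
  "finite_rect_R d lam p =
     (let m = nat \<lfloor>real d / lam\<rfloor>
      in Poly (map (\<lambda>n. logderiv_fps d m p $ n) [0..<Suc d]))"

definition cauchy_G :: "real pmf \<Rightarrow> complex \<Rightarrow> complex" where
  "cauchy_G \<mu> z = (\<integral>t. 1 / (z - complex_of_real t) \<partial>measure_pmf \<mu>)"

definition H_rect :: "real \<Rightarrow> real pmf \<Rightarrow> complex \<Rightarrow> complex" where
  "H_rect lam \<mu> x =
     complex_of_real lam * (cauchy_G \<mu> (1 / csqrt x))\<^sup>2
     + complex_of_real (1 - lam) * csqrt x * cauchy_G \<mu> (1 / csqrt x)"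

definition U_rect :: "real \<Rightarrow> complex \<Rightarrow> complex" where
  "U_rect lam x =
     (- complex_of_real lam - 1
      + csqrt ((complex_of_real lam + 1)\<^sup>2 + 4 * complex_of_real lam * x))
     / (2 * complex_of_real lam)"

end

theory Submission
  imports Defs "HOL-Complex_Analysis.Complex_Analysis"
begin

text \<open>
  Write \<open>\<theta> = s d/ds\<close>, let \<open>M(x) = \<Sum>\<^sub>k\<^sub>\<ge>\<^sub>1 m\<^sub>k x\<^sup>k\<close> be the generating function of the even moments of \<open>\<mu>\<close>,
  and put \<open>e(s) = \<Prod>(1 - \<rho>\<^sub>i s)\<close>. Newton's identities \<open>\<theta>e = - d M e\<close>, transported to the series \<open>E\<close>
  (whose coefficients differ from those of \<open>e\<close> by explicit weights), say that \<open>R = - \<theta>E / (d E)\<close> equals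
  \<open>\<Sum>\<^sub>k m\<^sub>k Y\<^sub>k\<close>, where \<open>Y\<^sub>0 = 1\<close>, \<open>Y\<^sub>k = s W\<^sub>k\<close> and
  \<open>(1 + R - \<theta>/d) (1 + \<lambda>R - \<theta>/m) W\<^sub>k = Y\<^sub>k\<^sub>-\<^sub>1\<close> below degree \<open>d\<close>.
  For \<open>d \<rightarrow> \<infinity>\<close> the \<open>\<theta>\<close>-terms disappear coefficientwise, and the limit satisfies \<open>R = M(y)\<close> with
  \<open>y (1 + R) (1 + \<lambda>R) = s\<close>; this is the equation of the free transform, with \<open>y\<close> the inverse of
  \<open>H(x) = x (1 + M(x)) (1 + \<lambda>M(x))\<close>.

  Pointwise convergence follows by dominated convergence from a bound \<open>|R\<^sub>n| \<le> K\<^sup>n\<close>, for \<open>n \<le> d\<close>, that is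
  uniform in \<open>d\<close>. For \<open>n \<le> d/2\<close> the operators \<open>1 - \<theta>/d\<close> and \<open>1 - \<theta>/m\<close> multiply the \<open>n\<close>-th coefficient
  by at least \<open>1/2\<close>, so the system above can be solved in a weighted \<open>\<ell>\<^sup>1\<close>-norm. For \<open>d/2 < n \<le> d\<close> one
  divides \<open>E\<close> by the exponential of the part of \<open>log E\<close> already controlled: up to a factor, \<open>R\<^sub>n\<close> is the
  \<open>n\<close>-th coefficient of the quotient, and a bound exponential in \<open>d \<le> 2n\<close> is enough.
\<close>

unbundle no vec_syntax

section \<open>Weighted norms of truncated power series\<close>

text \<open>Cut off at degree \<open>N\<close> because the equations for \<open>R\<close> and
  \<open>Y\<close> hold only below degree d and are well conditioned only up to d/2; the cut-off is
  also the induction variable in \<open>trunc_norm_R\<close>.\<close>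

definition trunc_norm :: "real \<Rightarrow> nat \<Rightarrow> real fps \<Rightarrow> real" where
  "trunc_norm t N f = (\<Sum>n\<le>N. \<bar>f $ n\<bar> * t ^ n)"

lemma trunc_norm_nonneg: "0 \<le> t \<Longrightarrow> 0 \<le> trunc_norm t N f"
  by (auto simp: trunc_norm_def intro!: sum_nonneg)

lemma abs_nth_le_trunc_norm: "0 \<le> t \<Longrightarrow> n \<le> N \<Longrightarrow> \<bar>f $ n\<bar> * t ^ n \<le> trunc_norm t N f"
  unfolding trunc_norm_def
  by (rule member_le_sum[where f = "\<lambda>n. \<bar>f $ n\<bar> * t ^ n"]) auto

lemma trunc_norm_mono: "0 \<le> t \<Longrightarrow> N \<le> N' \<Longrightarrow> trunc_norm t N f \<le> trunc_norm t N' f"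
  unfolding trunc_norm_def by (rule sum_mono2) auto

lemma trunc_norm_mult:
  assumes "0 \<le> t"
  shows "trunc_norm t N (f * g) \<le> trunc_norm t N f * trunc_norm t N g"
proof -
  have "trunc_norm t N (f * g) \<le> (\<Sum>n\<le>N. \<Sum>i\<le>n. (\<bar>f $ i\<bar> * t ^ i) * (\<bar>g $ (n - i)\<bar> * t ^ (n - i)))"
    unfolding trunc_norm_def
  proof (rule sum_mono)
    fix n assume "n \<in> {..N}"
    have "\<bar>(f * g) $ n\<bar> * t ^ n \<le> (\<Sum>i\<le>n. \<bar>f $ i * g $ (n - i)\<bar>) * t ^ n"
      using assms by (intro mult_right_mono) (auto simp: fps_mult_nth atMost_atLeast0)
    also have "\<dots> = (\<Sum>i\<le>n. (\<bar>f $ i\<bar> * t ^ i) * (\<bar>g $ (n - i)\<bar> * t ^ (n - i)))"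
      unfolding sum_distrib_right
    proof (rule sum.cong)
      fix i assume "i \<in> {..n}"
      then have "t ^ n = t ^ i * t ^ (n - i)"
        by (simp flip: power_add)
      then show "\<bar>f $ i * g $ (n - i)\<bar> * t ^ n = (\<bar>f $ i\<bar> * t ^ i) * (\<bar>g $ (n - i)\<bar> * t ^ (n - i))"
        by (simp add: abs_mult)
    qed simp
    finally show "\<bar>(f * g) $ n\<bar> * t ^ n \<le> \<dots>" .
  qed
  also have "\<dots> = (\<Sum>(i, j)\<in>{(i, j). i + j \<le> N}. (\<bar>f $ i\<bar> * t ^ i) * (\<bar>g $ j\<bar> * t ^ j))"
    by (rule sum.triangle_reindex_eq[symmetric])
  also have "\<dots> \<le> (\<Sum>(i, j)\<in>{..N} \<times> {..N}. (\<bar>f $ i\<bar> * t ^ i) * (\<bar>g $ j\<bar> * t ^ j))"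
    using assms by (intro sum_mono2) auto
  also have "\<dots> = trunc_norm t N f * trunc_norm t N g"
    by (simp add: trunc_norm_def sum_product sum.cartesian_product)
  finally show ?thesis .
qed

lemma trunc_norm_cmult: "trunc_norm t N (fps_const c * f) = \<bar>c\<bar> * trunc_norm t N f"
  by (simp add: trunc_norm_def sum_distrib_left abs_mult mult.assoc)

lemma trunc_norm_one: "trunc_norm t N 1 = 1"
  by (simp add: trunc_norm_def sum.atMost_shift)

lemma trunc_norm_power:
  assumes "0 \<le> t"
  shows "trunc_norm t N (f ^ k) \<le> trunc_norm t N f ^ k"
proof (induction k)
  case (Suc k)
  have "trunc_norm t N (f ^ Suc k) \<le> trunc_norm t N f * trunc_norm t N (f ^ k)"
    using trunc_norm_mult[OF assms] by simp
  also have "\<dots> \<le> trunc_norm t N f * trunc_norm t N f ^ k"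
    by (intro mult_left_mono Suc trunc_norm_nonneg assms)
  finally show ?case
    by simp
qed (simp add: trunc_norm_one)

lemma trunc_norm_sum:
  assumes "0 \<le> t"
  shows "trunc_norm t N (\<Sum>k\<in>A. f k) \<le> (\<Sum>k\<in>A. trunc_norm t N (f k))"
proof -
  have "trunc_norm t N (\<Sum>k\<in>A. f k) \<le> (\<Sum>n\<le>N. \<Sum>k\<in>A. \<bar>f k $ n\<bar> * t ^ n)"
    unfolding trunc_norm_def sum_distrib_right[symmetric] fps_sum_nth using assms
    by (intro sum_mono mult_right_mono) auto
  also have "\<dots> = (\<Sum>k\<in>A. trunc_norm t N (f k))"
    unfolding trunc_norm_def by (rule sum.swap)
  finally show ?thesis .
qed

text \<open>Multiplication by s gains one degree; this lets the induction in
  \<open>trunc_norm_R\<close> advance.\<close>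

lemma trunc_norm_X_mult: "trunc_norm t (Suc N) (fps_X * f) = t * trunc_norm t N f"
  unfolding trunc_norm_def
  by (subst sum.atMost_Suc_shift) (simp add: sum_distrib_left mult_ac)

lemma sum_exp_series_le:
  fixes x :: real
  assumes "0 \<le> x"
  shows "(\<Sum>i\<le>N. x ^ i / fact i) \<le> exp x"
proof -
  have "(\<Sum>i\<le>N. x ^ i / fact i) = (\<Sum>i\<le>N. x ^ i /\<^sub>R fact i)"
    by (simp add: divide_inverse_commute)
  also have "\<dots> \<le> exp x"
    unfolding exp_def using assms summable_exp[of x] by (intro sum_le_suminf summable_exp_generic) auto
  finally show ?thesis .
qed

text \<open>Coefficient n involves only the powers \<open>f ^ i\<close> with i \<le> n. Enlarging
  the range to i \<le> N leaves, by submultiplicativity, a partial sum of the exponential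
  series.\<close>

lemma trunc_norm_exp_compose:
  assumes "0 \<le> t"
  shows "trunc_norm t N (fps_exp 1 oo f) \<le> exp (trunc_norm t N f)"
proof -
  have "trunc_norm t N (fps_exp 1 oo f) \<le> (\<Sum>n\<le>N. \<Sum>i\<le>N. \<bar>(f ^ i) $ n\<bar> * t ^ n / fact i)"
    unfolding trunc_norm_def
  proof (rule sum_mono)
    fix n assume n: "n \<in> {..N}"
    have "\<bar>(fps_exp 1 oo f) $ n\<bar> * t ^ n \<le> (\<Sum>i=0..n. \<bar>(f ^ i) $ n / fact i\<bar>) * t ^ n"
      unfolding fps_compose_nth using assms by (intro mult_right_mono sum_abs[THEN order_trans]) auto
    also have "\<dots> = (\<Sum>i=0..n. \<bar>(f ^ i) $ n\<bar> * t ^ n / fact i)"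
      by (simp add: sum_distrib_right)
    also have "\<dots> \<le> (\<Sum>i\<le>N. \<bar>(f ^ i) $ n\<bar> * t ^ n / fact i)"
      using assms n by (intro sum_mono2) auto
    finally show "\<bar>(fps_exp 1 oo f) $ n\<bar> * t ^ n \<le> \<dots>" .
  qed
  also have "\<dots> = (\<Sum>i\<le>N. trunc_norm t N (f ^ i) / fact i)"
    unfolding trunc_norm_def sum_divide_distrib by (rule sum.swap)
  also have "\<dots> \<le> (\<Sum>i\<le>N. trunc_norm t N f ^ i / fact i)"
    by (intro sum_mono divide_right_mono trunc_norm_power assms) auto
  also have "\<dots> \<le> exp (trunc_norm t N f)"
    by (intro sum_exp_series_le trunc_norm_nonneg assms)
  finally show ?thesis .
qed

text \<open>
  Conjugating \<open>f \<mapsto> f - c \<theta>f\<close> by a series \<open>E\<close> with \<open>\<theta>E = - a S E\<close> turns it into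
  \<open>f \<mapsto> (1 + c a S) f - c \<theta>f\<close>.
\<close>
definition log_pert :: "real \<Rightarrow> real fps \<Rightarrow> real fps \<Rightarrow> real fps" where
  "log_pert c S f = f + S * f - fps_const c * (fps_X * fps_deriv f)"

lemma fps_X_deriv_nth: "(fps_X * fps_deriv f) $ n = of_nat n * f $ n"
  by (cases n) auto

lemma log_pert_nth: "log_pert c S f $ n = (1 - c * real n) * f $ n + (S * f) $ n"
  unfolding log_pert_def fps_sub_nth fps_add_nth fps_mult_left_const_nth fps_X_deriv_nth
  by (simp add: algebra_simps)

text \<open>Up to degree \<open>N\<close> the diagonal factor 1 - c n is at least 1/2, so the norm
  of \<open>f\<close> is at most twice that of \<open>g\<close> plus twice that of
  \<open>S * f\<close>; the last term is at most half the norm of \<open>f\<close> and is absorbed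
  on the left.\<close>

lemma trunc_norm_log_pert:
  assumes t: "0 \<le> t" and c: "c * real N \<le> 1 / 2" "0 \<le> c" and S: "trunc_norm t N S \<le> 1 / 4"
    and eq: "\<And>n. n \<le> N \<Longrightarrow> log_pert c S f $ n = g $ n"
  shows "trunc_norm t N f \<le> 4 * trunc_norm t N g"
proof -
  have *: "\<bar>f $ n\<bar> \<le> 2 * \<bar>g $ n\<bar> + 2 * \<bar>(S * f) $ n\<bar>" if "n \<le> N" for n
  proof -
    have "c * real n \<le> c * real N"
      using that c by (intro mult_left_mono) auto
    then have cn: "1 / 2 \<le> 1 - c * real n"
      using c by simp
    then have "1 / 2 * \<bar>f $ n\<bar> \<le> \<bar>1 - c * real n\<bar> * \<bar>f $ n\<bar>"
      by (intro mult_right_mono) auto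
    also have "\<dots> = \<bar>g $ n - (S * f) $ n\<bar>"
      using eq[OF that] by (simp add: log_pert_nth flip: abs_mult)
    finally show ?thesis
      by linarith
  qed
  have "trunc_norm t N f \<le> (\<Sum>n\<le>N. (2 * \<bar>g $ n\<bar> + 2 * \<bar>(S * f) $ n\<bar>) * t ^ n)"
    unfolding trunc_norm_def using * t by (intro sum_mono mult_right_mono) auto
  also have "\<dots> = 2 * trunc_norm t N g + 2 * trunc_norm t N (S * f)"
    by (simp add: trunc_norm_def sum_distrib_left sum.distrib algebra_simps)
  also have "trunc_norm t N (S * f) \<le> trunc_norm t N S * trunc_norm t N f"
    by (rule trunc_norm_mult[OF t])
  also have "\<dots> \<le> 1 / 4 * trunc_norm t N f"
    by (intro mult_right_mono S trunc_norm_nonneg t)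
  finally show ?thesis
    by linarith
qed

lemma fps_mult_nth_cong:
  assumes "\<And>i. i \<le> n \<Longrightarrow> f $ i = g $ i"
  shows "(f * h) $ n = (g * h) $ n"
  unfolding fps_mult_nth using assms by (intro sum.cong) auto

lemma log_pert_mult:
  assumes "fps_X * fps_deriv E = - (fps_const a * S * E)"
  shows "log_pert c (fps_const (c * a) * S) f * E
       = f * E - fps_const c * (fps_X * fps_deriv (f * E))"
proof -
  have "fps_X * fps_deriv (f * E) = f * (fps_X * fps_deriv E) + (fps_X * fps_deriv f) * E"
    unfolding fps_deriv_mult by (simp only: ring_distribs mult_ac)
  also have "\<dots> = - (fps_const a * S * f * E) + (fps_X * fps_deriv f) * E"
    unfolding assms by (simp only: mult_minus_right mult_ac)
  finally have *: "fps_X * fps_deriv (f * E) = - (fps_const a * S * f * E) + (fps_X * fps_deriv f) * E" .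
  have "(f + C * A * S * f - C * D) * E = f * E - C * (- (A * S * f * E) + D * E)"
    for C A D :: "real fps"
    by (simp add: algebra_simps)
  then show ?thesis
    unfolding log_pert_def * fps_const_mult[symmetric] .
qed

section \<open>The nonlinear system behind Newton's identities\<close>

text \<open>Here \<open>e\<close> stands for the reversed polynomial with factors 1 - \<rho> s, and
  \<open>real d * M k\<close> for the k-th power sum of the roots \<rho>; only Newton's identities
  between them are kept.\<close>

locale rect_newton =
  fixes d m :: nat and M :: "nat \<Rightarrow> real" and e :: "real fps"
  assumes d_pos: "0 < d" and d_le_m: "d \<le> m" and e_0: "e $ 0 = 1"
    and newton: "\<And>i. real i * e $ i = - real d * (\<Sum>k=1..i. M k * e $ (i - k))"
begin

definition wt :: "nat \<Rightarrow> real" where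
  "wt i = (real m * real d) ^ i * (fact (m - i) * fact (d - i) / (fact m * fact d))"

text \<open>\<open>V 0\<close> is E. \<open>V k\<close> comes from s^k e, but the weight is that of
  the shifted position i, so \<open>Y k\<close> is not simply s^k; in the limit it becomes the k-th
  power of a series y.\<close>

definition V :: "nat \<Rightarrow> real fps" where
  "V k = Abs_fps (\<lambda>i. if k \<le> i \<and> i \<le> d then wt i * e $ (i - k) else 0)"

definition R :: "real fps" where
  "R = fps_const (- 1 / real d) * fps_X * fps_deriv (V 0) * inverse (V 0)"

definition Y :: "nat \<Rightarrow> real fps" where
  "Y k = V k * inverse (V 0)"

definition W :: "nat \<Rightarrow> real fps" where
  "W k = fps_shift 1 (V k) * inverse (V 0)"

text \<open>The halfway stage between \<open>W k\<close> and \<open>Y (k - 1)\<close>: only the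
  operator with \<theta>/m has been applied. The ratio d/m plays the part of \<lambda>.\<close>

definition Z :: "nat \<Rightarrow> real fps" where
  "Z k = log_pert (1 / real m) (fps_const (real d / real m) * R) (W k)"

lemma m_pos: "0 < m"
  using d_pos d_le_m by simp

lemma V0_0: "V 0 $ 0 = 1"
  by (simp add: V_def wt_def e_0)

lemma V0_inverse: "V 0 * inverse (V 0) = 1" "inverse (V 0) * V 0 = 1"
  using inverse_mult_eq_1[of "V 0"] V0_0 by (simp_all add: mult.commute)

text \<open>
  By this recursion, passing from \<open>V (k + 1)\<close>, shifted down by one, to \<open>V k\<close> is the action of
  \<open>(1 - \<theta>/m) (1 - \<theta>/d)\<close> below degree \<open>d\<close>.
\<close>
lemma wt_Suc:
  assumes "n < d"
  shows "wt (Suc n) * ((1 - real n / real m) * (1 - real n / real d)) = wt n"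
proof -
  have "m - n = Suc (m - Suc n)" "d - n = Suc (d - Suc n)"
    using assms d_le_m by auto
  then have fm: "fact (m - n) = (real m - real n) * fact (m - Suc n)"
    and fd: "fact (d - n) = (real d - real n) * fact (d - Suc n)"
    by (simp_all add: field_simps)
  have "real m * (1 - real n / real m) = real m - real n"
       "real d * (1 - real n / real d) = real d - real n"
    using d_pos m_pos by (simp_all add: field_simps)
  then have "real m * real d * ((1 - real n / real m) * (1 - real n / real d))
      = (real m - real n) * (real d - real n)"
    by (metis mult.assoc mult.left_commute)
  then show ?thesis
    unfolding wt_def fm fd power_Suc by (simp add: mult_ac)
qed

lemma X_deriv_V0: "fps_X * fps_deriv (V 0) = - (fps_const (real d) * R * V 0)"
proof -
  have "fps_const (real d) * R * V 0
      = (fps_const (real d) * fps_const (- 1 / real d)) * (fps_X * fps_deriv (V 0))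
          * (inverse (V 0) * V 0)"
    unfolding R_def by (simp only: mult_ac)
  also have "fps_const (real d) * fps_const (- 1 / real d) = - 1"
    using d_pos by (simp flip: fps_const_neg)
  finally show ?thesis
    by (simp add: V0_inverse)
qed

lemma R_nth_0: "R $ 0 = 0"
  by (simp add: R_def mult.assoc)

text \<open>The weight depends only on i, so Newton's identity at i can be multiplied by
  \<open>wt i\<close> and becomes a relation between \<open>V 0\<close> and the \<open>V k\<close>,
  which is then divided by \<open>V 0\<close>. Terms with k > i vanish in \<open>V k\<close>, whence
  the common upper limit d.\<close>

lemma R_eq: "R = (\<Sum>k=1..d. fps_const (M k) * Y k)"
proof -
  have "R * V 0 = (\<Sum>k=1..d. fps_const (M k) * V k)"
  proof (rule fps_ext)
    fix i
    have "- real d * (R * V 0) $ i = (fps_X * fps_deriv (V 0)) $ i"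
      unfolding X_deriv_V0 by (simp add: mult.assoc)
    also have "\<dots> = real i * V 0 $ i"
      by (rule fps_X_deriv_nth)
    also have "\<dots> = - real d * (\<Sum>k=1..d. M k * V k $ i)"
    proof (cases "i \<le> d")
      case True
      have "real i * V 0 $ i = wt i * (real i * e $ i)"
        using True by (simp add: V_def)
      also have "\<dots> = - real d * (\<Sum>k=1..i. M k * (wt i * e $ (i - k)))"
        unfolding newton by (simp add: sum_distrib_left mult_ac)
      also have "(\<Sum>k=1..i. M k * (wt i * e $ (i - k))) = (\<Sum>k=1..d. M k * V k $ i)"
        using True by (intro sum.mono_neutral_cong_left) (auto simp: V_def)
      finally show ?thesis .
    qed (simp add: V_def)
    finally show "(R * V 0) $ i = (\<Sum>k=1..d. fps_const (M k) * V k) $ i"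
      using d_pos by (simp add: fps_sum_nth)
  qed
  then have "R * V 0 * inverse (V 0) = (\<Sum>k=1..d. fps_const (M k) * Y k)"
    by (simp add: sum_distrib_right Y_def mult.assoc)
  then show ?thesis
    by (simp add: mult.assoc V0_inverse)
qed

lemma Y_0: "Y 0 = 1"
  by (simp add: Y_def V0_inverse)

lemma X_mult_W: "fps_X * W (Suc k) = Y (Suc k)"
proof -
  have "fps_X * fps_shift 1 (V (Suc k)) = V (Suc k)"
    by (rule fps_ext) (auto simp: V_def)
  then show ?thesis
    by (simp add: W_def Y_def flip: mult.assoc)
qed

lemma Y_nth_less: "n < k \<Longrightarrow> Y k $ n = 0"
  unfolding Y_def fps_mult_nth by (intro sum.neutral) (auto simp: V_def)

lemma R_nth: "n \<le> d \<Longrightarrow> R $ n = (\<Sum>k=1..n. M k * Y k $ n)"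
  unfolding R_eq fps_sum_nth fps_mult_left_const_nth
  by (intro sum.mono_neutral_right) (auto simp: Y_nth_less)

text \<open>After multiplication by \<open>V 0\<close> both operators are diagonal, by
  \<open>log_pert_mult\<close>, and \<open>wt_Suc\<close> identifies the result with
  \<open>V k\<close> up to degree n. Coefficient n of a product sees nothing higher, so
  \<open>V 0\<close> can be divided out again.\<close>

lemma log_pert_Z:
  assumes "n < d"
  shows "log_pert (1 / real d) R (Z (Suc k)) $ n = Y k $ n"
proof -
  let ?h = "fps_shift 1 (V (Suc k))"
  have WV: "W (Suc k) * V 0 = ?h"
    by (simp add: W_def mult.assoc V0_inverse)
  have ZV: "Z (Suc k) * V 0 = ?h - fps_const (1 / real m) * (fps_X * fps_deriv ?h)"
    using log_pert_mult[OF X_deriv_V0, of "1 / real m" "W (Suc k)"] by (simp add: Z_def WV)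
  have LV: "log_pert (1 / real d) R (Z (Suc k)) * V 0
      = Z (Suc k) * V 0 - fps_const (1 / real d) * (fps_X * fps_deriv (Z (Suc k) * V 0))"
    using log_pert_mult[OF X_deriv_V0, of "1 / real d" "Z (Suc k)"] d_pos by simp
  have "(log_pert (1 / real d) R (Z (Suc k)) * V 0) $ i = V k $ i" if "i \<le> n" for i
  proof -
    have "(Z (Suc k) * V 0) $ i = (1 - real i / real m) * ?h $ i"
      unfolding ZV fps_sub_nth fps_mult_left_const_nth fps_X_deriv_nth by (simp add: algebra_simps)
    moreover have "(log_pert (1 / real d) R (Z (Suc k)) * V 0) $ i
        = (1 - real i / real d) * (Z (Suc k) * V 0) $ i"
      unfolding LV fps_sub_nth fps_mult_left_const_nth fps_X_deriv_nth by (simp add: algebra_simps)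
    ultimately have "(log_pert (1 / real d) R (Z (Suc k)) * V 0) $ i
        = (1 - real i / real m) * (1 - real i / real d) * V (Suc k) $ Suc i"
      by simp
    also have "\<dots> = V k $ i"
      using wt_Suc[of i] that assms by (simp add: V_def mult_ac)
    finally show ?thesis .
  qed
  then have "(log_pert (1 / real d) R (Z (Suc k)) * V 0 * inverse (V 0)) $ n
      = (V k * inverse (V 0)) $ n"
    by (intro fps_mult_nth_cong) auto
  then show ?thesis
    by (simp add: mult.assoc V0_inverse Y_def)
qed

section \<open>Exponential coefficient bounds uniform in d\<close>

lemma trunc_norm_Y_Suc:
  assumes t: "0 \<le> t" and N: "2 * N \<le> d" and R: "trunc_norm t N R \<le> 1 / 4"
  shows "trunc_norm t (Suc N) (Y (Suc k)) \<le> 16 * t * trunc_norm t N (Y k)"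
proof -
  have "real d / real m * trunc_norm t N R \<le> 1 * (1 / 4)"
    using d_le_m m_pos by (intro mult_mono R trunc_norm_nonneg t) auto
  then have S: "trunc_norm t N (fps_const (real d / real m) * R) \<le> 1 / 4"
    by (simp add: trunc_norm_cmult)
  \<comment> \<open>Each of the two operators is inverted at the price of a factor 4, using N/d
    \<le> 1/2 and N/m \<le> 1/2; passing from \<open>W\<close> to \<open>Y\<close> adds the factor
    t.\<close>
  have "trunc_norm t N (W (Suc k)) \<le> 4 * trunc_norm t N (Z (Suc k))"
    using m_pos d_le_m N by (intro trunc_norm_log_pert[OF t _ _ S]) (auto simp: Z_def field_simps)
  moreover have "trunc_norm t N (Z (Suc k)) \<le> 4 * trunc_norm t N (Y k)"
    using d_pos N
    by (intro trunc_norm_log_pert[OF t _ _ R, where c = "1 / real d"] log_pert_Z) (auto simp: field_simps)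
  ultimately have "t * trunc_norm t N (W (Suc k)) \<le> t * (16 * trunc_norm t N (Y k))"
    using t by (intro mult_left_mono) auto
  then show ?thesis
    unfolding X_mult_W[symmetric] trunc_norm_X_mult by simp
qed

text \<open>Bootstrap on the degree: the bound 1/4 up to \<open>N\<close> controls every
  \<open>Y k\<close> up to \<open>N + 1\<close>, and \<open>R_eq\<close> returns the same bound for
  \<open>R\<close> up to \<open>N + 1\<close>.\<close>

lemma trunc_norm_R:
  assumes M: "\<And>k. \<bar>M k\<bar> \<le> B ^ k" and B: "0 < B" and N: "2 * N \<le> d"
  shows "trunc_norm (1 / (80 * B)) N R \<le> 1 / 4"
  using N
proof (induction N)
  case 0
  then show ?case
    by (simp add: trunc_norm_def R_nth_0)
next
  case (Suc N)
  \<comment> \<open>80 = 16 * 5: each \<open>Y\<close> costs 16 t, so the k-th term is at most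
    5^(-k), and these sum to at most 1/4 over k \<ge> 1.\<close>
  define t where "t = 1 / (80 * B)"
  have t: "0 \<le> t" and Bt: "B * (16 * t) = 1 / 5"
    using B by (auto simp: t_def)
  have IH: "trunc_norm t N R \<le> 1 / 4"
    using Suc by (simp add: t_def)
  have Y: "trunc_norm t (Suc N) (Y k) \<le> (16 * t) ^ k" for k
  proof (induction k)
    case (Suc k)
    have "trunc_norm t (Suc N) (Y (Suc k)) \<le> 16 * t * trunc_norm t N (Y k)"
      using t IH \<open>2 * Suc N \<le> d\<close> by (intro trunc_norm_Y_Suc) auto
    also have "\<dots> \<le> 16 * t * trunc_norm t (Suc N) (Y k)"
      using t by (intro mult_left_mono trunc_norm_mono) auto
    also have "\<dots> \<le> 16 * t * (16 * t) ^ k"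
      using t Suc by (intro mult_left_mono) auto
    finally show ?case
      by simp
  qed (simp add: Y_0 trunc_norm_one)
  have geom: "(\<Sum>k=1..n. (1 / 5) ^ k) = 1 / 4 - (1 / 5 :: real) ^ n / 4" for n
    by (induction n) auto
  have "trunc_norm t (Suc N) R \<le> (\<Sum>k=1..d. \<bar>M k\<bar> * trunc_norm t (Suc N) (Y k))"
    unfolding R_eq by (rule trunc_norm_sum[OF t, THEN order_trans]) (simp add: trunc_norm_cmult)
  also have "\<dots> \<le> (\<Sum>k=1..d. B ^ k * (16 * t) ^ k)"
    using B by (intro sum_mono mult_mono M Y trunc_norm_nonneg t) auto
  also have "\<dots> = (\<Sum>k=1..d. (1 / 5) ^ k)"
    by (simp only: power_mult_distrib[symmetric] Bt)
  also have "\<dots> = 1 / 4 - (1 / 5) ^ d / 4"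
    by (rule geom)
  also have "\<dots> \<le> 1 / 4"
    by simp
  finally show ?case
    by (simp add: t_def)
qed

text \<open>Combined with the binomial bound on \<open>e\<close>, the weight leaves m^i (m-i)!/m!
  times (d B t)^i / i!. The first factor is at most m^m/m! \<le> e^m, and the second sums to an
  exponential.\<close>

lemma trunc_norm_V0:
  assumes e: "\<And>i. \<bar>e $ i\<bar> \<le> real (d choose i) * B ^ i" and B: "0 \<le> B" and t: "0 \<le> t"
  shows "trunc_norm t d (V 0) \<le> exp (real m + real d * B * t)"
proof -
  have "\<bar>V 0 $ i\<bar> * t ^ i \<le> exp (real m) * ((real d * B * t) ^ i / fact i)" if "i \<le> d" for i
  proof -
    have "i \<le> m"
      using that d_le_m by simp
    have wt0: "0 \<le> wt i"
      by (simp add: wt_def)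
    have "fact (m - i) \<le> (real (m - i)) ^ (m - i)"
      by (metis fact_le_power of_nat_fact of_nat_le_iff of_nat_power order_refl)
    also have "\<dots> \<le> real m ^ (m - i)"
      by (intro power_mono) auto
    finally have "real m ^ i * fact (m - i) \<le> real m ^ i * real m ^ (m - i)"
      by (intro mult_left_mono) auto
    also have "\<dots> = real m ^ m"
      using \<open>i \<le> m\<close> by (simp flip: power_add)
    finally have "real m ^ i * fact (m - i) / fact m \<le> real m ^ m / fact m"
      by (intro divide_right_mono) auto
    also have "\<dots> \<le> (\<Sum>j\<le>m. real m ^ j / fact j)"
      by (rule member_le_sum) auto
    also have "\<dots> \<le> exp (real m)"
      by (rule sum_exp_series_le) simp
    finally have em: "real m ^ i * fact (m - i) / fact m \<le> exp (real m)" .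
    have "\<bar>V 0 $ i\<bar> * t ^ i = wt i * \<bar>e $ i\<bar> * t ^ i"
      using that wt0 by (simp add: V_def abs_mult)
    also have "\<dots> \<le> wt i * (real (d choose i) * B ^ i) * t ^ i"
      by (intro mult_right_mono mult_left_mono e wt0) (use t in auto)
    also have "\<dots> = (real m ^ i * fact (m - i) / fact m) * ((real d * B * t) ^ i / fact i)"
      using that by (simp add: wt_def binomial_fact power_mult_distrib)
    also have "\<dots> \<le> exp (real m) * ((real d * B * t) ^ i / fact i)"
      using B t by (intro mult_right_mono em) auto
    finally show ?thesis .
  qed
  then have "trunc_norm t d (V 0) \<le> (\<Sum>i\<le>d. exp (real m) * ((real d * B * t) ^ i / fact i))"
    unfolding trunc_norm_def by (intro sum_mono) auto
  also have "\<dots> = exp (real m) * (\<Sum>i\<le>d. (real d * B * t) ^ i / fact i)"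
    by (simp add: sum_distrib_left)
  also have "\<dots> \<le> exp (real m) * exp (real d * B * t)"
    using B t by (intro mult_left_mono sum_exp_series_le) auto
  finally show ?thesis
    by (simp add: exp_add)
qed

text \<open>
  With \<open>S\<close> the part of \<open>R\<close> of degree at most \<open>d/2\<close>, the series \<open>P = E exp(d \<integral>S/s)\<close> is
  \<open>1 + O(s\<^bsup>d/2\<^esup>)\<close> and satisfies \<open>\<theta>P = - d (R - S) P\<close>, so \<open>R\<^sub>n = - n P\<^sub>n / d\<close> for \<open>d/2 < n \<le> d\<close>.
\<close>
lemma abs_R_nth_upper_half:
  assumes n: "d div 2 < n" "n \<le> d" and t: "0 \<le> t"
  shows "\<bar>R $ n\<bar> * t ^ n \<le> trunc_norm t d (V 0) * exp (real d * trunc_norm t (d div 2) R)"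
proof -
  define N where "N = d div 2"
  \<comment> \<open>This is d times the integral of S/s; the constant coefficient is 0 because
    division by zero yields 0.\<close>
  define T where "T = Abs_fps (\<lambda>n. if n \<le> N then real d * R $ n / real n else 0)"
  define S where "S = Abs_fps (\<lambda>n. if n \<le> N then R $ n else 0)"
  define G where "G = fps_exp 1 oo T"
  define P where "P = V 0 * G"
  have T0: "T $ 0 = 0"
    by (simp add: T_def)
  have XT: "fps_X * fps_deriv T = fps_const (real d) * S"
    by (rule fps_ext, unfold fps_X_deriv_nth) (auto simp: T_def S_def R_nth_0)
  have "fps_X * fps_deriv G = fps_const (real d) * S * G"
    unfolding G_def XT[symmetric] by (simp add: fps_compose_deriv[OF T0] mult_ac)
  moreover have "fps_X * fps_deriv P = (fps_X * fps_deriv (V 0)) * G + V 0 * (fps_X * fps_deriv G)"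
    unfolding P_def fps_deriv_mult by (simp only: ring_distribs mult_ac add_ac)
  ultimately have "fps_X * fps_deriv P = fps_const (real d) * ((S - R) * P)"
    unfolding X_deriv_V0 P_def by (simp only: algebra_simps mult_minus_right add.right_inverse add_0_right add_0_left)
  then have "real i * P $ i = real d * ((S - R) * P) $ i" for i
    by (metis fps_X_deriv_nth fps_mult_left_const_nth)
  moreover have "(S - R) * P = - ((R - S) * P)"
    by (simp add: algebra_simps)
  ultimately have P_nth: "real i * P $ i = - real d * ((R - S) * P) $ i" for i
    by (metis fps_neg_nth mult_minus_left mult_minus_right)
  have RS: "(R - S) $ i = (if i \<le> N then 0 else R $ i)" for i
    by (simp add: S_def)
  have P0: "P $ 0 = 1"
    by (simp add: P_def V0_0 G_def)
  have Pi: "P $ i = 0" if "0 < i" "i \<le> N" for i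
  proof -
    have "((R - S) * P) $ i = 0"
      unfolding fps_mult_nth using that by (intro sum.neutral) (auto simp: RS simp del: fps_sub_nth)
    then show ?thesis
      using P_nth[of i] that by simp
  qed
  have "((R - S) * P) $ n = (\<Sum>i=0..n. if i = n then R $ n else 0)"
    unfolding fps_mult_nth
  proof (rule sum.cong)
    fix i assume "i \<in> {0..n}"
    \<comment> \<open>For i \<le> N the factor \<open>R - S\<close> vanishes. For N < i < n one has
      0 < n - i \<le> N, from n \<le> d \<le> 2N + 1, and there \<open>P\<close> vanishes. Only i =
      n survives.\<close>
    then consider "i \<le> N" | "N < i" "i < n" "0 < n - i" "n - i \<le> N" | "i = n"
      using n unfolding N_def by fastforce
    then show "(R - S) $ i * P $ (n - i) = (if i = n then R $ n else 0)"
      using n by cases (auto simp: RS Pi P0 N_def simp del: fps_sub_nth)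
  qed simp
  then have "real n * P $ n = - real d * R $ n"
    using P_nth[of n] by simp
  then have "real d * \<bar>R $ n\<bar> = real n * \<bar>P $ n\<bar>"
    by (metis abs_minus_cancel abs_mult abs_of_nat mult_minus_left)
  also have "\<dots> \<le> real d * \<bar>P $ n\<bar>"
    using n by (intro mult_right_mono) auto
  finally have "\<bar>R $ n\<bar> \<le> \<bar>P $ n\<bar>"
    using d_pos by simp
  then have "\<bar>R $ n\<bar> * t ^ n \<le> \<bar>P $ n\<bar> * t ^ n"
    using t by (intro mult_right_mono) auto
  also have "\<dots> \<le> trunc_norm t d P"
    by (rule abs_nth_le_trunc_norm[OF t n(2)])
  also have "\<dots> \<le> trunc_norm t d (V 0) * trunc_norm t d G"
    unfolding P_def by (rule trunc_norm_mult[OF t])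
  also have "trunc_norm t d G \<le> exp (trunc_norm t d T)"
    unfolding G_def by (rule trunc_norm_exp_compose[OF t])
  also have "trunc_norm t d T \<le> real d * trunc_norm t N R"
  proof -
    have "trunc_norm t d T = (\<Sum>i\<le>N. \<bar>T $ i\<bar> * t ^ i)"
      unfolding trunc_norm_def by (rule sum.mono_neutral_right) (auto simp: T_def N_def)
    also have "\<dots> \<le> (\<Sum>i\<le>N. real d * (\<bar>R $ i\<bar> * t ^ i))"
    proof (rule sum_mono)
      fix i assume i: "i \<in> {..N}"
      have "\<bar>R $ i\<bar> / real i \<le> \<bar>R $ i\<bar>"
        by (cases i) (auto simp: R_nth_0 field_simps)
      then have "real d * (\<bar>R $ i\<bar> / real i) * t ^ i \<le> real d * \<bar>R $ i\<bar> * t ^ i"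
        using t by (intro mult_right_mono mult_left_mono) auto
      then show "\<bar>T $ i\<bar> * t ^ i \<le> real d * (\<bar>R $ i\<bar> * t ^ i)"
        using i by (simp add: T_def abs_mult mult.assoc)
    qed
    finally show ?thesis
      by (simp add: trunc_norm_def sum_distrib_left)
  qed
  finally show ?thesis
    using t by (simp add: N_def mult_left_mono trunc_norm_nonneg)
qed

text \<open>In the lower half \<open>trunc_norm_R\<close> suffices. In the upper half the bound is
  exponential in d, and d \<le> 2n turns it into an n-th power: hence the 2 in the exponent, while
  80 B is 1/t.\<close>

lemma abs_R_nth_le:
  assumes M: "\<And>k. \<bar>M k\<bar> \<le> B ^ k" and e: "\<And>i. \<bar>e $ i\<bar> \<le> real (d choose i) * B ^ i"
    and B: "0 < B" and L: "real m \<le> L * real d" and n: "n \<le> d"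
  shows "\<bar>R $ n\<bar> \<le> (80 * B * exp (2 * (L + 1))) ^ n"
proof -
  define t where "t = 1 / (80 * B)"
  have t: "0 < t"
    using B by (simp add: t_def)
  have RN: "trunc_norm t (d div 2) R \<le> 1 / 4"
    unfolding t_def by (rule trunc_norm_R[OF M B]) auto
  have "0 < L * real d"
    using L m_pos by (meson less_le_trans of_nat_0_less_iff)
  then have L0: "0 < L"
    using d_pos by (simp add: zero_less_mult_iff)
  have "\<bar>R $ n\<bar> * t ^ n \<le> exp (2 * (L + 1)) ^ n"
  proof (cases "n \<le> d div 2")
    case True
    then have "\<bar>R $ n\<bar> * t ^ n \<le> 1 / 4"
      using abs_nth_le_trunc_norm[of t n "d div 2" R] RN t by simp
    also have "\<dots> \<le> exp (2 * (L + 1)) ^ n"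
      using L0 by (intro order_trans[OF _ one_le_power]) auto
    finally show ?thesis .
  next
    case False
    have "\<bar>R $ n\<bar> * t ^ n \<le> trunc_norm t d (V 0) * exp (real d * trunc_norm t (d div 2) R)"
      using False n t by (intro abs_R_nth_upper_half) auto
    also have "\<dots> \<le> exp (real m + real d * B * t) * exp (real d * (1 / 4))"
      using B t d_pos RN by (intro mult_mono trunc_norm_V0 e) auto
    also have "\<dots> = exp (real m + real d * (1 / 80 + 1 / 4))"
      using B by (simp add: t_def exp_add[symmetric] algebra_simps)
    also have "\<dots> \<le> exp (real n * (2 * (L + 1)))"
    proof -
      have "real m + real d * (1 / 80 + 1 / 4) \<le> real d * (L + 1)"
        using L by (simp add: algebra_simps)
      also have "\<dots> \<le> (2 * real n) * (L + 1)"
        using False L0 by (intro mult_right_mono) auto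
      finally show ?thesis
        by (simp add: mult_ac)
    qed
    finally show ?thesis
      by (simp add: exp_of_nat_mult)
  qed
  then show ?thesis
    using t B by (simp add: t_def field_simps power_mult_distrib)
qed

end

section \<open>Coefficientwise limit\<close>

text \<open>Since \<open>S\<close> eventually has no constant term, coefficient i of the equation
  determines \<open>f $ i\<close> from earlier ones, with divisor 1 - c i tending to 1. By strong
  induction the recursion converges to the one encoded by (1 + s) z = h.\<close>

lemma tendsto_log_pert_solution:
  fixes f g S :: "'i \<Rightarrow> real fps" and z h s :: "complex fps"
  assumes eq: "eventually (\<lambda>d. \<forall>i\<le>n. log_pert (c d) (S d) (f d) $ i = g d $ i) F"
    and c: "(c \<longlongrightarrow> 0) F" and S0: "eventually (\<lambda>d. S d $ 0 = 0) F" and s0: "s $ 0 = 0"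
    and S: "\<And>i. i \<le> n \<Longrightarrow> ((\<lambda>d. complex_of_real (S d $ i)) \<longlongrightarrow> s $ i) F"
    and g: "\<And>i. i \<le> n \<Longrightarrow> ((\<lambda>d. complex_of_real (g d $ i)) \<longlongrightarrow> h $ i) F"
    and z: "(1 + s) * z = h" and i: "i \<le> n"
  shows "((\<lambda>d. complex_of_real (f d $ i)) \<longlongrightarrow> z $ i) F"
  using i
proof (induction i rule: less_induct)
  case (less i)
  have conv: "(a * b) $ i = (\<Sum>j=1..i. a $ j * b $ (i - j))" if "a $ 0 = 0" for a b :: "'c::comm_ring_1 fps"
    unfolding fps_mult_nth using that by (simp add: sum.atLeast_Suc_atMost)
  have "((\<lambda>d. (complex_of_real (g d $ i) - (\<Sum>j=1..i. complex_of_real (S d $ j) * complex_of_real (f d $ (i - j))))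
           / complex_of_real (1 - c d * real i))
        \<longlongrightarrow> (h $ i - (\<Sum>j=1..i. s $ j * z $ (i - j))) / complex_of_real (1 - 0 * real i)) F"
    using less.prems by (intro tendsto_intros g S c less.IH) auto
  also have "h $ i - (\<Sum>j=1..i. s $ j * z $ (i - j)) = z $ i"
    using z[symmetric] conv[OF s0, of z] by (simp add: ring_distribs)
  finally have lim: "((\<lambda>d. (complex_of_real (g d $ i)
        - (\<Sum>j=1..i. complex_of_real (S d $ j) * complex_of_real (f d $ (i - j))))
           / complex_of_real (1 - c d * real i)) \<longlongrightarrow> z $ i) F"
    by simp
  have "((\<lambda>d. 1 - c d * real i) \<longlongrightarrow> 1 - 0 * real i) F"
    by (intro tendsto_intros c)
  then have "eventually (\<lambda>d. 0 < 1 - c d * real i) F"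
    by (rule order_tendstoD) simp
  with eq S0 have "eventually (\<lambda>d. (complex_of_real (g d $ i)
        - (\<Sum>j=1..i. complex_of_real (S d $ j) * complex_of_real (f d $ (i - j))))
           / complex_of_real (1 - c d * real i) = complex_of_real (f d $ i)) F"
  proof eventually_elim
    case (elim d)
    have "(1 - c d * real i) * f d $ i + (S d * f d) $ i = g d $ i"
      using elim(1) less.prems by (simp add: log_pert_nth)
    then have "(1 - c d * real i) * f d $ i = g d $ i - (\<Sum>j=1..i. S d $ j * f d $ (i - j))"
      unfolding conv[OF elim(2), of "f d"] by linarith
    then have "f d $ i = (g d $ i - (\<Sum>j=1..i. S d $ j * f d $ (i - j))) / (1 - c d * real i)"
      using elim(3) by (simp add: field_simps)
    then have "complex_of_real (f d $ i)
        = complex_of_real ((g d $ i - (\<Sum>j=1..i. S d $ j * f d $ (i - j))) / (1 - c d * real i))"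
      by simp
    then show ?case
      by simp
  qed
  with lim show ?case
    by (rule Lim_transform_eventually)
qed

text \<open>The limiting system, with the \<theta>-terms gone: \<open>y ^ k\<close> replaces
  \<open>Y k\<close>, and the shifted power replaces \<open>W (k + 1)\<close>. Multiply by s, insert
  the equation for \<open>y\<close>, and cancel s.\<close>

lemma fps_shift_power_Suc_equation:
  fixes y r :: "complex fps"
  assumes y: "y * ((1 + r) * (1 + fps_const a * r)) = fps_X" and y0: "y $ 0 = 0"
  shows "(1 + r) * ((1 + fps_const a * r) * fps_shift 1 (y ^ Suc k)) = y ^ k"
proof -
  have X: "fps_X * fps_shift 1 (y ^ Suc k) = y ^ Suc k"
    by (rule fps_ext) (auto simp: y0)
  have "fps_X * ((1 + r) * ((1 + fps_const a * r) * fps_shift 1 (y ^ Suc k)))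
      = (1 + r) * (1 + fps_const a * r) * (fps_X * fps_shift 1 (y ^ Suc k))"
    by (simp only: mult_ac)
  also have "\<dots> = (y * ((1 + r) * (1 + fps_const a * r))) * y ^ k"
    unfolding X by (simp only: mult_ac power_Suc)
  finally have "fps_X * ((1 + r) * ((1 + fps_const a * r) * fps_shift 1 (y ^ Suc k))) = fps_X * y ^ k"
    unfolding y .
  then show ?thesis
    by (simp only: mult_cancel_left fps_X_neq_zero) simp
qed

lemma rect_newton_R_tendsto:
  fixes y r :: "complex fps" and D :: "nat set" and m :: "nat \<Rightarrow> nat" and e :: "nat \<Rightarrow> real fps"
  assumes sys: "\<And>d. d \<in> D \<Longrightarrow> rect_newton d (m d) M (e d)"
    and m: "\<And>d. d \<in> D \<Longrightarrow> real (m d) = real d / lam" and lam: "0 < lam"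
    and y: "y * ((1 + r) * (1 + fps_const (complex_of_real lam) * r)) = fps_X" and y0: "y $ 0 = 0"
    and r: "r = (Abs_fps (\<lambda>k. complex_of_real (M k)) oo y) - 1" and M0: "M 0 = 1"
  shows "((\<lambda>d. complex_of_real (rect_newton.R d (m d) (e d) $ n)) \<longlongrightarrow> r $ n) (sequentially \<sqinter> principal D)"
proof -
  define F where "F = (sequentially \<sqinter> principal D :: nat filter)"
  define R where "R d = rect_newton.R d (m d) (e d)" for d
  define Y where "Y d = rect_newton.Y d (m d) (e d)" for d
  define Z where "Z d = rect_newton.Z d (m d) (e d)" for d
  define W where "W d = rect_newton.W d (m d) (e d)" for d
  note defs = R_def Y_def Z_def W_def
  let ?a = "fps_const (complex_of_real lam)"
  have evD: "eventually P F" if "\<And>d. d \<in> D \<Longrightarrow> n \<le> d \<Longrightarrow> P d" for P n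
    unfolding F_def eventually_inf_principal
    using eventually_ge_at_top[of n] by eventually_elim (use that in auto)
  have r0: "r $ 0 = 0"
    using M0 by (simp add: r)
  have inv_d: "((\<lambda>d. 1 / real d) \<longlongrightarrow> 0) F"
    unfolding F_def by (rule tendsto_mono[OF inf_le1 lim_1_over_n])
  have R0: "eventually (\<lambda>d. R d $ 0 = 0) F"
    by (rule evD) (use sys in \<open>auto simp: defs rect_newton.R_nth_0[OF sys]\<close>)
  have "((\<lambda>d. lam * (1 / real d)) \<longlongrightarrow> lam * 0) F"
    by (intro tendsto_intros inv_d)
  moreover have "eventually (\<lambda>d. lam * (1 / real d) = 1 / real (m d)) F"
    by (rule evD) (use m lam in auto)
  ultimately have inv_m: "((\<lambda>d. 1 / real (m d)) \<longlongrightarrow> 0) F"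
    using Lim_transform_eventually by fastforce
  \<comment> \<open>Joint induction, for all k at once: because of the factor s, coefficient n of
    \<open>Y k\<close> uses \<open>Y (k - 1)\<close> and \<open>R\<close> only below n;
    \<open>R_nth\<close> then yields \<open>R $ n\<close>.\<close>
  have "(\<forall>k. ((\<lambda>d. complex_of_real (Y d k $ n)) \<longlongrightarrow> (y ^ k) $ n) F)
      \<and> ((\<lambda>d. complex_of_real (R d $ n)) \<longlongrightarrow> r $ n) F" for n
  proof (induction n rule: less_induct)
    case (less n)
    have Y: "((\<lambda>d. complex_of_real (Y d k $ n)) \<longlongrightarrow> (y ^ k) $ n) F" for k
    proof (cases k)
      case 0
      have "eventually (\<lambda>d. (y ^ k) $ n = complex_of_real (Y d k $ n)) F"
        by (rule evD) (use sys in \<open>auto simp: defs 0 rect_newton.Y_0[OF sys]\<close>)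
      then show ?thesis
        by (rule Lim_transform_eventually[OF tendsto_const])
    next
      case (Suc k')
      show ?thesis
      proof (cases n)
        case 0
        have "eventually (\<lambda>d. (y ^ k) $ n = complex_of_real (Y d k $ n)) F"
          by (rule evD) (use sys in \<open>auto simp: defs 0 Suc rect_newton.Y_nth_less[OF sys] y0\<close>)
        then show ?thesis
          by (rule Lim_transform_eventually[OF tendsto_const])
      next
        case (Suc n')
        have IH_Y: "((\<lambda>d. complex_of_real (Y d k' $ i)) \<longlongrightarrow> (y ^ k') $ i) F"
          and IH_R: "((\<lambda>d. complex_of_real (R d $ i)) \<longlongrightarrow> r $ i) F" if "i \<le> n'" for i
          using less[of i] that Suc by simp_all
        let ?w = "fps_shift 1 (y ^ Suc k')"
        let ?z = "(1 + ?a * r) * ?w"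
        have Z: "((\<lambda>d. complex_of_real (Z d (Suc k') $ i)) \<longlongrightarrow> ?z $ i) F" if "i \<le> n'" for i
        proof (rule tendsto_log_pert_solution[where n = n' and S = R and s = r and g = "\<lambda>d. Y d k'"
              and c = "\<lambda>d. 1 / real d" and h = "y ^ k'"])
          show "eventually (\<lambda>d. \<forall>i\<le>n'. log_pert (1 / real d) (R d) (Z d (Suc k')) $ i = Y d k' $ i) F"
            by (rule evD[of "Suc n'"]) (use sys in \<open>auto simp: defs rect_newton.log_pert_Z[OF sys]\<close>)
          show "(1 + r) * ?z = y ^ k'"
            by (rule fps_shift_power_Suc_equation[OF y y0])
        qed (use IH_Y IH_R that R0 r0 inv_d in \<open>simp_all only:\<close>)
        have "((\<lambda>d. complex_of_real (W d (Suc k') $ n')) \<longlongrightarrow> ?w $ n') F"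
        proof (rule tendsto_log_pert_solution[where n = n' and S = "\<lambda>d. fps_const lam * R d"
              and s = "?a * r" and g = "\<lambda>d. Z d (Suc k')" and c = "\<lambda>d. 1 / real (m d)" and h = ?z])
          show "eventually (\<lambda>d. \<forall>i\<le>n'. log_pert (1 / real (m d)) (fps_const lam * R d) (W d (Suc k')) $ i
              = Z d (Suc k') $ i) F"
            by (rule evD[of 1]) (use sys m lam in \<open>auto simp: defs rect_newton.Z_def[OF sys]\<close>)
          show "((\<lambda>d. complex_of_real ((fps_const lam * R d) $ i)) \<longlongrightarrow> (?a * r) $ i) F"
            if "i \<le> n'" for i
            unfolding fps_mult_left_const_nth of_real_mult
            by (intro tendsto_intros IH_R that)
        qed (use Z R0 r0 inv_m in \<open>auto elim: eventually_mono\<close>)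
        moreover have "eventually (\<lambda>d. complex_of_real (W d (Suc k') $ n') = complex_of_real (Y d k $ n)) F"
        proof (rule evD)
          fix d assume "d \<in> D"
          then have "Y d k = fps_X * W d (Suc k')"
            using sys unfolding defs \<open>k = Suc k'\<close> by (simp add: rect_newton.X_mult_W[OF sys])
          then show "complex_of_real (W d (Suc k') $ n') = complex_of_real (Y d k $ n)"
            by (simp add: Suc)
        qed
        ultimately have "((\<lambda>d. complex_of_real (Y d k $ n)) \<longlongrightarrow> ?w $ n') F"
          by (rule Lim_transform_eventually)
        then show ?thesis
          by (simp add: Suc \<open>k = Suc k'\<close> del: power_Suc)
      qed
    qed
    have "((\<lambda>d. \<Sum>k=1..n. complex_of_real (M k) * complex_of_real (Y d k $ n))
        \<longlongrightarrow> (\<Sum>k=1..n. complex_of_real (M k) * (y ^ k) $ n)) F"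
      by (intro tendsto_intros Y)
    also have "(\<Sum>k=1..n. complex_of_real (M k) * (y ^ k) $ n) = r $ n"
      unfolding r by (simp add: fps_compose_nth sum.atLeast_Suc_atMost M0)
    finally have "((\<lambda>d. complex_of_real (R d $ n)) \<longlongrightarrow> r $ n) F"
    proof (rule Lim_transform_eventually, intro evD[of n])
      fix d assume d: "d \<in> D" "n \<le> d"
      show "(\<Sum>k=1..n. complex_of_real (M k) * complex_of_real (Y d k $ n)) = complex_of_real (R d $ n)"
        unfolding defs rect_newton.R_nth[OF sys[OF d(1)] d(2)] by simp
    qed
    with Y show ?case
      by blast
  qed
  then show ?thesis
    by (simp add: F_def R_def)
qed

section \<open>Roots and moments\<close>

lemma sum_mset_eq_sum_count:
  fixes f :: "'a \<Rightarrow> real"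
  assumes "finite S" "set_mset A \<subseteq> S"
  shows "(\<Sum>x\<in>#A. f x) = (\<Sum>x\<in>S. real (count A x) * f x)"
  using assms(2)
proof (induction A)
  case (add y A)
  have "(\<Sum>x\<in>S. real (count (add_mset y A) x) * f x)
      = (\<Sum>x\<in>S. (if x = y then f x else 0) + real (count A x) * f x)"
    by (intro sum.cong) (auto simp: algebra_simps)
  then show ?case
    using add assms(1) by (simp add: sum.distrib)
qed simp

lemma poly_split_proots:
  fixes p :: "'a::idom poly"
  assumes "p \<noteq> 0"
  shows "\<exists>q. p = q * (\<Prod>x\<in>#proots p. [:- x, 1:])"
  using assms
proof (induction "degree p" arbitrary: p rule: less_induct)
  case (less p)
  show ?case
  proof (cases "proots p = {#}")
    case False
    then obtain x where "x \<in># proots p"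
      by blast
    then have "poly p x = 0"
      using less.prems by (simp add: set_count_proots)
    then obtain q where q: "p = [:- x, 1:] * q"
      unfolding poly_eq_0_iff_dvd by (auto elim: dvdE)
    with less.prems have [simp]: "q \<noteq> 0"
      by auto
    have "degree q < degree p"
      unfolding q by (subst degree_mult_eq) auto
    then obtain q' where "q = q' * (\<Prod>x\<in>#proots q. [:- x, 1:])"
      using less.hyps by force
    moreover have "proots p = add_mset x (proots q)"
      unfolding q by (subst proots_mult) auto
    ultimately have "p = q' * (\<Prod>x\<in>#proots p. [:- x, 1:])"
      unfolding q by (metis (no_types, lifting) image_mset_add_mset mult.left_commute prod_mset.add_mset)
    then show ?thesis ..
  qed auto
qed

lemma poly_eq_prod_proots:
  fixes p :: "'a::idom poly"
  assumes p: "lead_coeff p = 1" "size (proots p) = degree p"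
  shows "p = (\<Prod>x\<in>#proots p. [:- x, 1:])"
proof -
  have monic: "lead_coeff (\<Prod>x\<in>#A. [:- x, 1:]) = 1 \<and> degree (\<Prod>x\<in>#A. [:- x, 1:]) = size A"
    for A :: "'a multiset"
  proof (induction A)
    case (add x A)
    then have "(\<Prod>x\<in>#A. [:- x, 1:]) \<noteq> 0"
      by auto
    then have "degree ([:- x, 1:] * (\<Prod>x\<in>#A. [:- x, 1:])) = Suc (size A)"
      using add by (subst degree_mult_eq) auto
    moreover have "lead_coeff ([:- x, 1:] * (\<Prod>x\<in>#A. [:- x, 1:])) = 1"
      using add by (subst lead_coeff_mult) auto
    ultimately show ?case
      by (simp del: mult_pCons_left)
  qed auto
  have "p \<noteq> 0"
    using p by auto
  then obtain q where q: "p = q * (\<Prod>x\<in>#proots p. [:- x, 1:])"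
    using poly_split_proots by blast
  with \<open>p \<noteq> 0\<close> have "q \<noteq> 0" "(\<Prod>x\<in>#proots p. [:- x, 1:]) \<noteq> 0"
    by auto
  then have "degree p = degree q + size (proots p)"
    using monic[of "proots p"] by (subst q, subst degree_mult_eq) auto
  then have "degree q = 0"
    using p by simp
  moreover have "lead_coeff q = 1"
    using p(1) monic[of "proots p"] arg_cong[OF q, of lead_coeff] by (metis lead_coeff_mult mult.right_neutral)
  ultimately have "q = 1"
    by (metis degree_eq_zeroE lead_coeff_pCons(2) one_pCons)
  then show ?thesis
    using q by simp
qed

text \<open>The reversed monic polynomial as a power series; a root 0 contributes the factor
  1.\<close>

definition root_fps :: "'a::comm_ring_1 multiset \<Rightarrow> 'a fps" where
  "root_fps A = (\<Prod>x\<in>#A. 1 - fps_const x * fps_X)"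

lemma root_fps_empty: "root_fps {#} = 1"
  and root_fps_add: "root_fps (add_mset x A) = (1 - fps_const x * fps_X) * root_fps A"
  by (simp_all add: root_fps_def)

lemma root_fps_add_nth:
  "root_fps (add_mset x A) $ i = root_fps A $ i - (if i = 0 then 0 else x * root_fps A $ (i - 1))"
  by (simp add: root_fps_add left_diff_distrib mult.assoc)

lemma root_fps_nth_0: "root_fps A $ 0 = 1"
  by (induction A) (auto simp: root_fps_empty root_fps_add_nth)

lemma fps_of_reflect_prod:
  fixes A :: "'a::idom multiset"
  shows "fps_of_poly (reflect_poly (\<Prod>x\<in>#A. [:- x, 1:])) = root_fps A"
proof (induction A)
  case (add x A)
  have "reflect_poly [:- x, 1:] = [:1, - x:]"
    by (cases "x = 0") (auto simp: reflect_poly_def)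
  then show ?case
    using add
    by (simp add: root_fps_add reflect_poly_mult fps_of_poly_mult fps_of_poly_pCons
        del: mult_pCons_left flip: fps_const_neg)
qed (simp add: root_fps_empty)

lemma coeff_eq_root_fps_nth:
  fixes p :: "'a::idom poly"
  assumes p: "lead_coeff p = 1" "size (proots p) = degree p" and i: "i \<le> degree p"
  shows "coeff p (degree p - i) = root_fps (proots p) $ i"
proof -
  have "coeff p (degree p - i) = coeff (reflect_poly p) i"
    using i by (simp add: coeff_reflect_poly)
  then show ?thesis
    using fps_of_reflect_prod[of "proots p"] poly_eq_prod_proots[OF p]
    by (metis fps_of_poly_nth)
qed

text \<open>Up to sign, coefficient i is an elementary symmetric function, whose monomials the
  binomial coefficient counts; the induction is Pascal's rule.\<close>

lemma abs_root_fps_nth_le: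
  fixes A :: "real multiset"
  assumes "\<And>x. x \<in># A \<Longrightarrow> \<bar>x\<bar> \<le> B" and B: "0 \<le> B"
  shows "\<bar>root_fps A $ i\<bar> \<le> real (size A choose i) * B ^ i"
  using assms(1)
proof (induction A arbitrary: i)
  case empty
  then show ?case
    by (cases i) (auto simp: root_fps_empty)
next
  case (add x A)
  have IH: "\<bar>root_fps A $ i\<bar> \<le> real (size A choose i) * B ^ i" for i
    using add by simp
  show ?case
  proof (cases i)
    case 0
    then show ?thesis
      by (simp add: root_fps_nth_0)
  next
    case (Suc j)
    have "\<bar>root_fps (add_mset x A) $ i\<bar> \<le> \<bar>root_fps A $ Suc j\<bar> + \<bar>x\<bar> * \<bar>root_fps A $ j\<bar>"
      by (simp add: root_fps_add_nth Suc flip: abs_mult)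
    also have "\<dots> \<le> real (size A choose Suc j) * B ^ Suc j + B * (real (size A choose j) * B ^ j)"
      using add.prems B by (intro add_mono mult_mono IH) auto
    finally show ?thesis
      by (simp add: Suc algebra_simps)
  qed
qed

lemma root_fps_newton:
  fixes A :: "'a::comm_ring_1 multiset"
  shows "of_nat i * root_fps A $ i = - (\<Sum>k=1..i. (\<Sum>x\<in>#A. x ^ k) * root_fps A $ (i - k))"
proof -
  \<comment> \<open>\<open>Q x\<close> is xs/(1 - xs), minus the logarithmic derivative (for
    \<theta>) of the factor 1 - xs; summed over \<open>A\<close> it generates the power
    sums.\<close>
  define Q where "Q = (\<lambda>x::'a. Abs_fps (\<lambda>k. if k = 0 then 0 else x ^ k))"
  have Q: "(1 - fps_const x * fps_X) * Q x = fps_const x * fps_X" for x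
    by (rule fps_ext) (auto simp: Q_def left_diff_distrib mult.assoc power_eq_if)
  have "fps_X * fps_deriv (root_fps A) = - (root_fps A * (\<Sum>x\<in>#A. Q x))"
  proof (induction A)
    case (add x A)
    have "fps_X * fps_deriv (root_fps (add_mset x A))
        = (1 - fps_const x * fps_X) * (fps_X * fps_deriv (root_fps A)) - (fps_const x * fps_X) * root_fps A"
      by (simp add: root_fps_add algebra_simps)
    also have "\<dots> = - ((1 - fps_const x * fps_X) * root_fps A * (\<Sum>x\<in>#A. Q x))
        - (1 - fps_const x * fps_X) * Q x * root_fps A"
      unfolding add Q by (simp add: algebra_simps)
    also have "\<dots> = - ((1 - fps_const x * fps_X) * root_fps A * (\<Sum>x\<in>#add_mset x A. Q x))"
    proof -
      have "- (u * v * w) - u * q * v = - (u * v * (q + w))" for u v w q :: "'a fps"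
        by (simp add: algebra_simps)
      then show ?thesis
        by simp
    qed
    finally show ?case
      by (simp add: root_fps_add)
  qed (simp add: root_fps_empty)
  then have "of_nat i * root_fps A $ i = (- ((\<Sum>x\<in>#A. Q x) * root_fps A)) $ i"
    using fps_X_deriv_nth[of "root_fps A" i] by (simp add: mult.commute)
  moreover have Q_sum: "(\<Sum>x\<in>#A. Q x) $ k = (if k = 0 then 0 else (\<Sum>x\<in>#A. x ^ k))" for k
    by (induction A) (auto simp: Q_def)
  ultimately show ?thesis
    by (simp add: fps_mult_nth sum.atLeast_Suc_atMost)
qed

definition even_moment :: "real pmf \<Rightarrow> nat \<Rightarrow> real" where
  "even_moment \<mu> k = (\<Sum>t\<in>set_pmf \<mu>. pmf \<mu> t * t ^ (2 * k))"

text \<open>Each root x yields two points, \<open>sqrt x\<close> and \<open>- sqrt x\<close>, with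
  2k-th power x^k; the doubling cancels against the total count.\<close>

lemma even_moment_mu_S:
  assumes p: "proots p \<noteq> {#}" "\<forall>x\<in>#proots p. 0 \<le> x"
  shows "real (size (proots p)) * even_moment (mu_S p) k = (\<Sum>x\<in>#proots p. x ^ k)"
proof -
  let ?A = "sym_sqrt_roots p"
  have A: "?A \<noteq> {#}" and size: "size ?A = 2 * size (proots p)"
    using p by (auto simp: sym_sqrt_roots_def)
  have pos: "0 < size (proots p)"
    using p(1) by (simp add: nonempty_has_size)
  have "even_moment (mu_S p) k = (\<Sum>t\<in>set_mset ?A. real (count ?A t) * t ^ (2 * k)) / real (size ?A)"
    by (simp add: even_moment_def mu_S_def A sum_divide_distrib)
  also have "(\<Sum>t\<in>set_mset ?A. real (count ?A t) * t ^ (2 * k)) = (\<Sum>t\<in>#?A. t ^ (2 * k))"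
    by (rule sum_mset_eq_sum_count[symmetric]) auto
  also have "\<dots> = (\<Sum>x\<in>#proots p. sqrt x ^ (2 * k)) + (\<Sum>x\<in>#proots p. (- sqrt x) ^ (2 * k))"
    by (simp add: sym_sqrt_roots_def multiset.map_comp o_def)
  also have "(\<Sum>x\<in>#proots p. sqrt x ^ (2 * k)) = (\<Sum>x\<in>#proots p. x ^ k)"
    using p(2) by (intro arg_cong[where f = sum_mset] image_mset_cong) (simp add: power_mult)
  also have "(\<Sum>x\<in>#proots p. (- sqrt x) ^ (2 * k)) = (\<Sum>x\<in>#proots p. x ^ k)"
    using p(2) by (intro arg_cong[where f = sum_mset] image_mset_cong) (simp add: power_mult)
  finally show ?thesis
    using pos by (simp add: size field_simps)
qed

lemma even_moment_0: "finite (set_pmf \<mu>) \<Longrightarrow> even_moment \<mu> 0 = 1"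
  by (simp add: even_moment_def sum_pmf_eq_1)

lemma abs_even_moment_le:
  assumes fin: "finite (set_pmf \<mu>)" and B: "\<And>t. t \<in> set_pmf \<mu> \<Longrightarrow> t\<^sup>2 \<le> B"
  shows "\<bar>even_moment \<mu> k\<bar> \<le> B ^ k"
proof -
  have "\<bar>even_moment \<mu> k\<bar> \<le> (\<Sum>t\<in>set_pmf \<mu>. \<bar>pmf \<mu> t * t ^ (2 * k)\<bar>)"
    unfolding even_moment_def by (rule sum_abs)
  also have "\<dots> \<le> (\<Sum>t\<in>set_pmf \<mu>. pmf \<mu> t * B ^ k)"
    by (intro sum_mono) (auto simp: abs_mult power_mult intro!: mult_left_mono power_mono B)
  also have "\<dots> = B ^ k"
    using sum_pmf_eq_1[OF fin order_refl] by (simp flip: sum_distrib_right)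
  finally show ?thesis .
qed

section \<open>The free rectangular transform\<close>

text \<open>For finite support and small x this is 1 + M(x) in the notation of the overview: the
  constant term is included.\<close>

definition moment_gf :: "real pmf \<Rightarrow> complex \<Rightarrow> complex" where
  "moment_gf \<mu> x = (\<Sum>t\<in>set_pmf \<mu>. complex_of_real (pmf \<mu> t) / (1 - complex_of_real (t\<^sup>2) * x))"

lemma eventually_moment_denominator_small:
  fixes \<mu> :: "real pmf"
  assumes fin: "finite (set_pmf \<mu>)"
  shows "eventually (\<lambda>x. \<forall>t\<in>set_pmf \<mu>. norm (complex_of_real (t\<^sup>2) * x) < 1) (nhds 0)"
proof -
  have "eventually (\<lambda>x. norm (complex_of_real (t\<^sup>2) * x) < 1) (nhds 0)" for t
  proof -
    have "((\<lambda>x. norm (complex_of_real (t\<^sup>2) * x)) \<longlongrightarrow> norm (complex_of_real (t\<^sup>2) * 0)) (nhds 0)"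
      by (intro tendsto_intros filterlim_ident)
    then show ?thesis
      by (rule order_tendstoD) simp
  qed
  then show ?thesis
    using fin by (simp add: eventually_ball_finite)
qed

lemma moment_gf_has_fps_expansion:
  assumes fin: "finite (set_pmf \<mu>)"
  shows "moment_gf \<mu> has_fps_expansion Abs_fps (\<lambda>k. complex_of_real (even_moment \<mu> k))"
proof (rule has_fps_expansionI)
  show "eventually (\<lambda>u. (\<lambda>n. Abs_fps (\<lambda>k. complex_of_real (even_moment \<mu> k)) $ n * u ^ n) sums moment_gf \<mu> u) (nhds 0)"
    using eventually_moment_denominator_small[OF fin]
  proof eventually_elim
    case (elim u)
    have "(\<lambda>n. \<Sum>t\<in>set_pmf \<mu>. complex_of_real (pmf \<mu> t) * (complex_of_real (t\<^sup>2) * u) ^ n) sums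
        (\<Sum>t\<in>set_pmf \<mu>. complex_of_real (pmf \<mu> t) * (1 / (1 - complex_of_real (t\<^sup>2) * u)))"
      using elim by (intro sums_sum sums_mult geometric_sums) auto
    moreover have "(\<Sum>t\<in>set_pmf \<mu>. complex_of_real (pmf \<mu> t) * (complex_of_real (t\<^sup>2) * u) ^ n)
        = Abs_fps (\<lambda>k. complex_of_real (even_moment \<mu> k)) $ n * u ^ n" for n
      by (simp add: even_moment_def sum_distrib_right power_mult power_mult_distrib mult.assoc)
    ultimately show ?case
      by (simp add: moment_gf_def)
  qed
qed

text \<open>Averaging the integrand over t and -t gives c/(1 - c^2 t^2) with c =
  \<open>csqrt x\<close>, so the root survives only as a prefactor and disappears in
  \<open>H_rect\<close>.\<close>

lemma cauchy_G_symmetric: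
  assumes fin: "finite (set_pmf \<mu>)" and symm: "\<forall>x. pmf \<mu> (- x) = pmf \<mu> x" and x: "x \<noteq> 0"
    and small: "\<forall>t\<in>set_pmf \<mu>. norm (complex_of_real (t\<^sup>2) * x) < 1"
  shows "cauchy_G \<mu> (1 / csqrt x) = csqrt x * moment_gf \<mu> x"
proof -
  define c where "c = csqrt x"
  have c: "c \<noteq> 0" "c\<^sup>2 = x"
    using x by (auto simp: c_def)
  have G: "cauchy_G \<mu> (1 / c) = (\<Sum>t\<in>set_pmf \<mu>. complex_of_real (pmf \<mu> t) * (1 / (1 / c - complex_of_real t)))"
    unfolding cauchy_G_def
    by (subst integral_measure_pmf[OF fin]) (auto simp: scaleR_conv_of_real)
  have neg: "uminus ` set_pmf \<mu> = set_pmf \<mu>"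
  proof -
    have *: "- t \<in> set_pmf \<mu>" if "t \<in> set_pmf \<mu>" for t
      using that symm by (simp add: set_pmf_iff)
    show ?thesis
      using * by (force simp: image_iff)
  qed
  have "cauchy_G \<mu> (1 / c) = (\<Sum>t\<in>uminus ` set_pmf \<mu>. complex_of_real (pmf \<mu> t) * (1 / (1 / c - complex_of_real t)))"
    unfolding neg by (rule G)
  also have "\<dots> = (\<Sum>t\<in>set_pmf \<mu>. complex_of_real (pmf \<mu> t) * (1 / (1 / c + complex_of_real t)))"
    using symm by (subst sum.reindex) (auto simp: inj_on_def)
  finally have G': "cauchy_G \<mu> (1 / c) = \<dots>" .
  have "2 * cauchy_G \<mu> (1 / c) = (\<Sum>t\<in>set_pmf \<mu>. complex_of_real (pmf \<mu> t) *
      (1 / (1 / c - complex_of_real t) + 1 / (1 / c + complex_of_real t)))"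
    unfolding mult_2 by (subst (1) G, subst G') (simp only: sum.distrib ring_distribs)
  also have "\<dots> = (\<Sum>t\<in>set_pmf \<mu>. 2 * (c * (complex_of_real (pmf \<mu> t) / (1 - complex_of_real (t\<^sup>2) * x))))"
  proof (rule sum.cong)
    fix t assume t: "t \<in> set_pmf \<mu>"
    let ?T = "complex_of_real t"
    have "1 - complex_of_real (t\<^sup>2) * x \<noteq> 0"
      using small t by auto
    moreover have prod: "1 - complex_of_real (t\<^sup>2) * x = (1 - c * ?T) * (1 + c * ?T)"
      unfolding c(2)[symmetric] by (simp add: algebra_simps power2_eq_square)
    ultimately have nz: "1 - c * ?T \<noteq> 0" "1 + c * ?T \<noteq> 0"
      by auto
    have "1 / (1 / c - ?T) = c / (1 - c * ?T)" "1 / (1 / c + ?T) = c / (1 + c * ?T)"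
      using c by (simp_all add: divide_simps mult.commute)
    moreover have "c / (1 - c * ?T) + c / (1 + c * ?T) = 2 * c / ((1 - c * ?T) * (1 + c * ?T))"
      using nz by (simp add: add_frac_eq) (simp add: algebra_simps)
    ultimately show "complex_of_real (pmf \<mu> t) * (1 / (1 / c - ?T) + 1 / (1 / c + ?T))
        = 2 * (c * (complex_of_real (pmf \<mu> t) / (1 - complex_of_real (t\<^sup>2) * x)))"
      unfolding prod by simp
  qed simp
  also have "\<dots> = 2 * (c * moment_gf \<mu> x)"
    by (simp add: moment_gf_def sum_distrib_left)
  finally show ?thesis
    by (simp add: c_def)
qed

lemma H_rect_eq:
  assumes "finite (set_pmf \<mu>)" and "\<forall>x. pmf \<mu> (- x) = pmf \<mu> x" and "x \<noteq> 0"
    and "\<forall>t\<in>set_pmf \<mu>. norm (complex_of_real (t\<^sup>2) * x) < 1"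
  shows "H_rect lam \<mu> x = x * (moment_gf \<mu> x * (1 + complex_of_real lam * (moment_gf \<mu> x - 1)))"
proof -
  have "l * (c * g)\<^sup>2 + (1 - l) * c * (c * g) = c\<^sup>2 * (g * (1 + l * (g - 1)))" for l c g :: complex
    by (simp add: algebra_simps power2_eq_square)
  from this[of "complex_of_real lam" "csqrt x" "moment_gf \<mu> x"] show ?thesis
    by (simp add: H_rect_def cauchy_G_symmetric[OF assms])
qed

text \<open>The radicand is the square of 1 + \<lambda> + 2\<lambda>u, and the positive real part
  makes \<open>csqrt\<close> choose this root and not its negative.\<close>

lemma U_rect_eq:
  assumes "0 < lam" and "0 < Re (1 + complex_of_real lam + 2 * complex_of_real lam * u)"
  shows "U_rect lam ((1 + u) * (1 + complex_of_real lam * u) - 1) = u"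
proof -
  have "(complex_of_real lam + 1)\<^sup>2 + 4 * complex_of_real lam * ((1 + u) * (1 + complex_of_real lam * u) - 1)
      = (1 + complex_of_real lam + 2 * complex_of_real lam * u)\<^sup>2"
    by (simp add: algebra_simps power2_eq_square)
  then show ?thesis
    using assms by (simp add: U_rect_def csqrt_square)
qed

text \<open>The inverse property turns x / \<open>Hinv x\<close> into (1 + M)(1 + \<lambda>M) at
  \<open>Hinv x\<close>, and \<open>U_rect\<close> recovers M from it. Uniqueness of expansions
  transfers both equations to formal series.\<close>

lemma free_rect_R_fps:
  fixes Hinv R :: "complex \<Rightarrow> complex"
  assumes lam: "0 < lam" and fin: "finite (set_pmf \<mu>)" and symm: "\<forall>x. pmf \<mu> (- x) = pmf \<mu> x"
    and r: "0 < r" and Hinv_hol: "Hinv holomorphic_on ball 0 r" and Hinv_0: "Hinv 0 = 0"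
    and Hinv_inv: "\<forall>x\<in>ball 0 r. H_rect lam \<mu> (Hinv x) = x"
    and R_hol: "R holomorphic_on ball 0 r"
    and R_def: "\<forall>x\<in>ball 0 r - {0}. R x = U_rect lam (x / Hinv x - 1)"
  defines "y \<equiv> fps_expansion Hinv 0" and "\<rho> \<equiv> fps_expansion R 0"
  shows "y $ 0 = 0"
    and "\<rho> = (Abs_fps (\<lambda>k. complex_of_real (even_moment \<mu> k)) oo y) - 1"
    and "y * ((1 + \<rho>) * (1 + fps_const (complex_of_real lam) * \<rho>)) = fps_X"
proof -
  let ?M = "Abs_fps (\<lambda>k. complex_of_real (even_moment \<mu> k))"
  let ?l = "complex_of_real lam"
  define g where "g x = moment_gf \<mu> (Hinv x)" for x
  have y: "Hinv has_fps_expansion y" and \<rho>: "R has_fps_expansion \<rho>"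
    unfolding y_def \<rho>_def using r Hinv_hol R_hol
    by (auto intro!: has_fps_expansion_fps_expansion[of "ball 0 r"])
  show y0: "y $ 0 = 0"
    using y Hinv_0 by (simp add: fps_nth_fps_expansion)
  have g: "g has_fps_expansion (?M oo y)"
    unfolding g_def using has_fps_expansion_compose[OF moment_gf_has_fps_expansion[OF fin] y y0]
    by (simp add: o_def)
  have g0: "g 0 = 1"
    using fps_nth_fps_expansion[OF g, of 0] by (simp add: even_moment_0[OF fin])
  have tendsto_0: "(f \<longlongrightarrow> f 0) (nhds 0)" if "f has_fps_expansion f'" for f :: "complex \<Rightarrow> complex" and f'
    using has_fps_expansion_imp_continuous[OF that, of UNIV]
    by (simp add: continuous_within tendsto_at_iff_tendsto_nhds)
  have small: "eventually (\<lambda>x. \<forall>t\<in>set_pmf \<mu>. norm (complex_of_real (t\<^sup>2) * Hinv x) < 1) (nhds 0)"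
    using filterlim_iff[THEN iffD1, OF tendsto_0[OF y], unfolded Hinv_0]
      eventually_moment_denominator_small[OF fin] by blast
  have "((\<lambda>x. Re (1 + ?l + 2 * ?l * (g x - 1))) \<longlongrightarrow> Re (1 + ?l + 2 * ?l * (g 0 - 1))) (nhds 0)"
    by (intro tendsto_intros tendsto_0[OF g])
  then have pos: "eventually (\<lambda>x. 0 < Re (1 + ?l + 2 * ?l * (g x - 1))) (nhds 0)"
    by (rule order_tendstoD) (use lam in \<open>simp add: g0\<close>)
  have ball: "eventually (\<lambda>x. x \<in> ball 0 r) (nhds (0 :: complex))"
    using r by (intro eventually_nhds_in_open) auto
  have eqs: "eventually (\<lambda>x. x \<noteq> 0 \<longrightarrow> R x = g x - 1 \<and> Hinv x * (g x * (1 + ?l * (g x - 1))) = x) (nhds 0)"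
    using small pos ball
  proof eventually_elim
    case (elim x)
    show ?case
    proof
      assume x: "x \<noteq> 0"
      have H0: "H_rect lam \<mu> 0 = 0"
        using Hinv_inv[rule_format, of 0] r Hinv_0 by simp
      have Hx: "H_rect lam \<mu> (Hinv x) = x"
        using Hinv_inv elim(3) by blast
      with H0 x have nz: "Hinv x \<noteq> 0"
        by auto
      have H: "Hinv x * (g x * (1 + ?l * (g x - 1))) = x"
        using H_rect_eq[OF fin symm nz elim(1), of lam] Hx by (simp add: g_def)
      then have "x / Hinv x = (1 + (g x - 1)) * (1 + ?l * (g x - 1))"
        using nz by (simp add: field_simps)
      then have "R x = g x - 1"
        using R_def elim(3) x U_rect_eq[OF lam elim(2)] by simp
      with H show "R x = g x - 1 \<and> Hinv x * (g x * (1 + ?l * (g x - 1))) = x"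
        by simp
    qed
  qed
  \<comment> \<open>\<open>R_def\<close> says nothing at 0; continuity of both sides supplies the
    value.\<close>
  have "R 0 = g 0 - 1"
  proof (rule tendsto_unique)
    have *: "((\<lambda>x. R x) \<longlongrightarrow> R 0) (at 0)" "((\<lambda>x. g x - 1) \<longlongrightarrow> g 0 - 1) (at 0)"
      using tendsto_0[OF \<rho>] tendsto_0[OF g]
      by (auto simp: tendsto_at_iff_tendsto_nhds intro!: tendsto_intros)
    show "(R \<longlongrightarrow> R 0) (at 0)"
      using *(1) .
    have "eventually (\<lambda>x. g x - 1 = R x) (at 0)"
      using eqs by (auto simp: eventually_at_filter elim: eventually_mono)
    with *(2) show "(R \<longlongrightarrow> g 0 - 1) (at 0)"
      by (rule Lim_transform_eventually)
  qed simp
  with eqs have eqs': "eventually (\<lambda>x. R x = g x - 1 \<and> Hinv x * (g x * (1 + ?l * (g x - 1))) = x) (nhds 0)"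
    by (auto simp: Hinv_0 elim!: eventually_mono)
  have "(\<lambda>x. g x - 1) has_fps_expansion ((?M oo y) - 1)"
    by (intro fps_expansion_intros g)
  then have "R has_fps_expansion ((?M oo y) - 1)"
    using eqs' by (subst has_fps_expansion_cong[OF _ refl]) (auto elim: eventually_mono)
  then show "\<rho> = (?M oo y) - 1"
    by (rule fps_expansion_unique_complex[OF \<rho>])
  have "(\<lambda>x. Hinv x * ((1 + R x) * (1 + ?l * R x))) has_fps_expansion
      (y * ((1 + \<rho>) * (1 + fps_const ?l * \<rho>)))"
    by (intro fps_expansion_intros y \<rho>)
  moreover have "eventually (\<lambda>x. Hinv x * ((1 + R x) * (1 + ?l * R x)) = x) (nhds 0)"
    using eqs' by eventually_elim simp
  ultimately have "(\<lambda>x. x) has_fps_expansion (y * ((1 + \<rho>) * (1 + fps_const ?l * \<rho>)))"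
    using has_fps_expansion_cong[OF _ refl] by fast
  then show "y * ((1 + \<rho>) * (1 + fps_const ?l * \<rho>)) = fps_X"
    using has_fps_expansion_fps_X fps_expansion_unique_complex by blast
qed

section \<open>Specialization to the given polynomials and the two limits\<close>

lemma sqrt_root_in_set_pmf_mu_S:
  assumes "x \<in># proots p"
  shows "sqrt x \<in> set_pmf (mu_S p)"
proof -
  have "sqrt x \<in># sym_sqrt_roots p"
    using assms by (auto simp: sym_sqrt_roots_def)
  moreover from this have "sym_sqrt_roots p \<noteq> {#}"
    by auto
  ultimately show ?thesis
    by (simp add: mu_S_def)
qed

lemma rect_newton_of_poly:
  assumes d: "0 < d" "d \<le> m" and p: "lead_coeff p = 1" "degree p = d" "size (proots p) = d"
    and nonneg: "\<forall>x\<in>#proots p. 0 \<le> x" and \<mu>: "mu_S p = \<mu>"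
  shows "rect_newton d m (even_moment \<mu>) (root_fps (proots p))"
proof
  fix i
  have "real d * even_moment \<mu> k = (\<Sum>x\<in>#proots p. x ^ k)" for k
    using even_moment_mu_S[of p k] d p nonneg \<mu> by (cases "proots p = {#}") auto
  then show "real i * root_fps (proots p) $ i
      = - real d * (\<Sum>k=1..i. even_moment \<mu> k * root_fps (proots p) $ (i - k))"
    by (simp add: root_fps_newton sum_distrib_left sum_negf flip: mult.assoc)
qed (use d in \<open>auto simp: root_fps_nth_0\<close>)

lemma coeff_finite_rect_R:
  assumes sys: "rect_newton d m M (root_fps (proots p))" and m: "real m = real d / lam"
    and p: "lead_coeff p = 1" "degree p = d" "size (proots p) = d"
  shows "coeff (finite_rect_R d lam p) n
       = (if n \<le> d then rect_newton.R d m (root_fps (proots p)) $ n else 0)"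
proof -
  have m': "nat \<lfloor>real d / lam\<rfloor> = m"
    by (simp flip: m)
  have "E_fps d m p = rect_newton.V d m (root_fps (proots p)) 0"
  proof (rule fps_ext)
    fix i
    \<comment> \<open>The sign in \<open>pcoef\<close> cancels the (-1)^i of
      \<open>E_fps\<close>.\<close>
    show "E_fps d m p $ i = rect_newton.V d m (root_fps (proots p)) 0 $ i"
      using coeff_eq_root_fps_nth[of p i] p
      by (simp add: E_fps_def pcoef_def rect_newton.V_def[OF sys] rect_newton.wt_def[OF sys])
  qed
  then have "logderiv_fps d m p = rect_newton.R d m (root_fps (proots p))"
    by (simp add: logderiv_fps_def rect_newton.R_def[OF sys])
  then show ?thesis
    by (simp add: finite_rect_R_def m' Let_def coeff_Poly_eq nth_default_def del: upt_Suc)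
qed

theorem mainTheorem2:
  fixes lam :: real and \<mu> :: "real pmf" and D :: "nat set"
    and p :: "nat \<Rightarrow> real poly"
    and Hinv R :: "complex \<Rightarrow> complex" and r :: real
  assumes lam_pos: "0 < lam" and lam_le: "lam \<le> 1"
    and fin_supp: "finite (set_pmf \<mu>)"
    and symm: "\<forall>x. pmf \<mu> (- x) = pmf \<mu> x"
    and D_inf: "infinite D"
    and D_int: "\<forall>d\<in>D. 0 < d \<and> (\<exists>m::nat. real m = real d / lam)"
    and p_prop: "\<forall>d\<in>D. lead_coeff (p d) = 1 \<and> degree (p d) = d
                   \<and> size (proots (p d)) = d \<and> (\<forall>\<rho>\<in>#proots (p d). 0 \<le> \<rho>)
                   \<and> mu_S (p d) = \<mu>"
    and r_pos: "0 < r"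
    and Hinv_hol: "Hinv holomorphic_on ball 0 r"
    and Hinv_0: "Hinv 0 = 0"
    and Hinv_inv: "\<forall>x\<in>ball 0 r. H_rect lam \<mu> (Hinv x) = x"
    and R_hol: "R holomorphic_on ball 0 r"
    and R_def: "\<forall>x\<in>ball 0 r - {0}. R x = U_rect lam (x / Hinv x - 1)"
  shows "(\<forall>n. ((\<lambda>d. complex_of_real (coeff (finite_rect_R d lam (p d)) n))
                 \<longlongrightarrow> (deriv ^^ n) R 0 / fact n) (sequentially \<sqinter> principal D))
         \<and> (\<exists>\<epsilon>>0. \<forall>s::complex. norm s < \<epsilon> \<longrightarrow>
              ((\<lambda>d. poly (map_poly complex_of_real (finite_rect_R d lam (p d))) s)
                 \<longlongrightarrow> R s) (sequentially \<sqinter> principal D))"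
proof -
  define F where "F = (sequentially \<sqinter> principal D :: nat filter)"
  define m where "m d = nat \<lfloor>real d / lam\<rfloor>" for d
  define e where "e d = root_fps (proots (p d))" for d
  define \<kappa> where "\<kappa> d n = coeff (finite_rect_R d lam (p d)) n" for d n
  \<comment> \<open>Bounds all squared support points, hence the roots of every \<open>p d\<close>;
    the 1 makes it positive. It depends on \<mu> alone, so \<open>K\<close> does not depend on
    d.\<close>
  define B where "B = 1 + (\<Sum>t\<in>set_pmf \<mu>. t\<^sup>2)"
  define K where "K = 80 * B * exp (2 * (1 / lam + 1))"
  have B: "0 < B"
    unfolding B_def by (intro add_pos_nonneg sum_nonneg) auto
  then have K: "0 < K"
    by (simp add: K_def)
  have B_supp: "t\<^sup>2 \<le> B" if "t \<in> set_pmf \<mu>" for t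
    using member_le_sum[OF that, of "\<lambda>t. t\<^sup>2"] fin_supp by (auto simp: B_def)
  have m: "real (m d) = real d / lam" if "d \<in> D" for d
    using D_int that unfolding m_def by (metis floor_of_nat nat_int)
  have d_le_m: "d \<le> m d" if "d \<in> D" for d
  proof -
    have "lam * real (m d) \<le> 1 * real (m d)"
      using lam_le by (intro mult_right_mono) auto
    then have "real d \<le> real (m d)"
      using m[OF that] lam_pos by simp
    then show ?thesis
      by simp
  qed
  have sys: "rect_newton d (m d) (even_moment \<mu>) (e d)" if "d \<in> D" for d
    unfolding e_def using that D_int p_prop d_le_m by (intro rect_newton_of_poly) auto
  have \<kappa>: "\<kappa> d n = (if n \<le> d then rect_newton.R d (m d) (e d) $ n else 0)" if "d \<in> D" for d n
    unfolding \<kappa>_def e_def using p_prop that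
    by (intro coeff_finite_rect_R[OF sys[OF that, unfolded e_def] m[OF that]]) auto
  note free = free_rect_R_fps[OF lam_pos fin_supp symm r_pos Hinv_hol Hinv_0 Hinv_inv R_hol R_def]
  have R_nth: "fps_expansion R 0 $ n = (deriv ^^ n) R 0 / fact n" for n
    by (simp add: fps_expansion_def)
  have F_ev: "eventually (\<lambda>d. d \<in> D \<and> n \<le> d) F" for n
    unfolding F_def eventually_inf_principal using eventually_ge_at_top[of n]
    by eventually_elim auto
  have F_bot: "F \<noteq> bot"
    using D_inf unfolding F_def trivial_limit_def eventually_inf_principal eventually_sequentially
    by (metis infinite_nat_iff_unbounded_le)
  have lim: "((\<lambda>d. complex_of_real (\<kappa> d n)) \<longlongrightarrow> (deriv ^^ n) R 0 / fact n) F" for n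
  proof -
    have "((\<lambda>d. complex_of_real (rect_newton.R d (m d) (e d) $ n)) \<longlongrightarrow> (deriv ^^ n) R 0 / fact n) F"
      unfolding F_def R_nth[symmetric]
      by (rule rect_newton_R_tendsto[OF sys m lam_pos free(3,1,2) even_moment_0[OF fin_supp]])
    moreover have "eventually (\<lambda>d. complex_of_real (rect_newton.R d (m d) (e d) $ n) = complex_of_real (\<kappa> d n)) F"
      using F_ev[of n] by eventually_elim (simp add: \<kappa>)
    ultimately show ?thesis
      by (rule Lim_transform_eventually)
  qed
  have bound: "\<bar>\<kappa> d n\<bar> \<le> K ^ n" if d: "d \<in> D" for d n
  proof (cases "n \<le> d")
    case True
    have "mu_S (p d) = \<mu>" "size (proots (p d)) = d" "\<forall>x\<in>#proots (p d). 0 \<le> x" "0 < d"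
      using p_prop D_int d by auto
    then have "sqrt x \<in> set_pmf \<mu>" if "x \<in># proots (p d)" for x
      using sqrt_root_in_set_pmf_mu_S[OF that] by simp
    then have "\<bar>x\<bar> \<le> B" if "x \<in># proots (p d)" for x
      using B_supp[of "sqrt x"] that \<open>\<forall>x\<in>#proots (p d). 0 \<le> x\<close> by auto
    then have "\<bar>e d $ i\<bar> \<le> real (d choose i) * B ^ i" for i
      using abs_root_fps_nth_le[of "proots (p d)" B i] B \<open>size (proots (p d)) = d\<close> by (simp add: e_def)
    then have "\<bar>rect_newton.R d (m d) (e d) $ n\<bar> \<le> K ^ n"
      unfolding K_def using True B m[OF d]
      by (intro rect_newton.abs_R_nth_le[OF sys[OF d]] abs_even_moment_le fin_supp B_supp) auto
    then show ?thesis
      using True by (simp add: \<kappa>[OF d])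
  qed (use K in \<open>simp add: \<kappa>[OF d]\<close>)
  \<comment> \<open>Within radius r the Taylor series of \<open>R\<close> sums to \<open>R\<close>;
    within 1/K the geometric majorant for Tannery's theorem is summable.\<close>
  have "((\<lambda>d. poly (map_poly complex_of_real (finite_rect_R d lam (p d))) s) \<longlongrightarrow> R s) F"
    if s: "norm s < min r (1 / K)" for s
  proof -
    have "((\<lambda>d. \<Sum>n. complex_of_real (\<kappa> d n) * s ^ n) \<longlongrightarrow> (\<Sum>n. (deriv ^^ n) R 0 / fact n * s ^ n)) F"
    proof (rule tannerys_theorem[THEN conjunct2, THEN conjunct2])
      show "((\<lambda>d. complex_of_real (\<kappa> d n) * s ^ n) \<longlongrightarrow> (deriv ^^ n) R 0 / fact n * s ^ n) F" for n
        by (intro tendsto_intros lim)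
      show "summable (\<lambda>n. (K * norm s) ^ n)"
        using s K by (intro summable_geometric) (simp add: field_simps)
      have "eventually (\<lambda>x. True \<and> snd x \<in> D \<and> 0 \<le> snd x) (at_top \<times>\<^sub>F F)"
        by (rule eventually_prodI[OF _ F_ev]) simp
      then show "eventually (\<lambda>(n, d). norm (complex_of_real (\<kappa> d n) * s ^ n) \<le> (K * norm s) ^ n) (at_top \<times>\<^sub>F F)"
        by (rule eventually_mono)
           (auto simp: norm_mult norm_power power_mult_distrib intro!: mult_right_mono bound)
    qed (rule F_bot)
    also have "(\<lambda>d. \<Sum>n. complex_of_real (\<kappa> d n) * s ^ n)
        = (\<lambda>d. poly (map_poly complex_of_real (finite_rect_R d lam (p d))) s)"
    proof
      fix d
      let ?q = "map_poly complex_of_real (finite_rect_R d lam (p d))"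
      have "(\<Sum>n. coeff ?q n * s ^ n) = poly ?q s"
        unfolding poly_altdef by (rule suminf_finite) (auto simp: coeff_eq_0)
      then show "(\<Sum>n. complex_of_real (\<kappa> d n) * s ^ n) = poly ?q s"
        by (simp add: coeff_map_poly \<kappa>_def)
    qed
    also have "(\<Sum>n. (deriv ^^ n) R 0 / fact n * s ^ n) = R s"
      using holomorphic_power_series[OF R_hol, of s] s by (simp add: sums_iff)
    finally show ?thesis .
  qed
  moreover have "0 < min r (1 / K)"
    using r_pos K by simp
  ultimately show ?thesis
    using lim unfolding F_def \<kappa>_def by blast
qed

end
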